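(* Let $\{S_e : e\in\mathcal{E}\}$ be a strongly connected graph directed iterated function system (GD-IFS) in $\mathbb{R}^d$ with attractor $(K_1,\ldots,K_q)$, such that at least one $K_i$ contains at least two points, let $j\in\mathcal{V}=\{1,\dots,q\}$, let $d_2\in\mathbb{N}$, let $L:\mathbb{R}^d\to\mathbb{R}^{d_2}$ be a linear map and assume that $|\mathcal{T}_{j,G}|<\infty$. Then there exists $\delta\geq0$ such that for every $\varepsilon>0$ $$\delta+\dim_H\left\{y\in L(K_j):\dim_H(L^{-1}(y)\cap K_j)\geq\delta-\varepsilon\right\}\geq\dim_H K_j.$$
   Context: Let $G(\mathcal{V},\mathcal{E})$ be a directed graph with vertex set $\mathcal{V}=\{1,\ldots,q\}$ and finite set $\mathcal{E}$ of directed edges (several edges between two vertices and loops are allowed) such that at least one edge starts from each vertex. $\mathcal{E}_{i,j}$ is the set of edges from $i$ to $j$, and $\mathcal{E}_{i,j}^k$ is the set of sequences $(e_1,\ldots,e_k)$ of $k$ edges forming a directed path from $i$ to $j$. A GD-IFS in $\mathbb{R}^d$ is a collection $\{S_e:e\in\mathcal{E}\}$ of contracting similarities of $\mathbb{R}^d$; write $S_e(x)=r_eT_e(x)+v_e$ with $0<r_e<1$, $T_e$ orthogonal, $v_e\in\mathbb{R}^d$. Its attractor is the unique $q$-tuple $(K_1,\ldots,K_q)$ of nonempty compact sets with $K_i=\bigcup_{j=1}^q\bigcup_{e\in\mathcal{E}_{i,j}}S_e(K_j)$ for all $i$. It is strongly connected if for every pair of vertices $i,j$ there is a directed path from $i$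 to $j$ and one from $j$ to $i$. $\mathcal{C}_j=\bigcup_{k\ge1}\mathcal{E}_{j,j}^k$ is the set of directed cycles starting and ending at $j$, and $\mathcal{T}_{j,G}$, the $j$-th transformation group, is the group generated by $\{T_{e_1}\circ\cdots\circ T_{e_k}:(e_1,\ldots,e_k)\in\mathcal{C}_j\}$; $|\mathcal{T}_{j,G}|$ is its cardinality. $\dim_H$ is Hausdorff dimension, with the convention $\dim_H(\emptyset)=-\infty$. *)

theory Defs
  imports
    "HOL-Analysis.Analysis"
    "HOL-Algebra.Generated_Groups"
    "Graph_Theory.Digraph_Component"
begin

section \<open>Hausdorff dimension\<close>

text \<open>
  The value \<open>|U|\<^sup>s\<close>, with the convention that \<open>|U|\<^sup>0 = 1\<close> for every nonempty \<open>U\<close>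
  (singletons included, although \<open>0 powr 0 = 0\<close> in HOL), and that empty sets contribute nothing.
\<close>

definition diam_pow :: "real \<Rightarrow> 'a::metric_space set \<Rightarrow> ennreal" where
  "diam_pow s U =
     (if U = {} then 0 else if s = 0 then 1 else ennreal (diameter U powr s))"

text \<open>
  Countable covers are sequences of sets; finite covers are padded with \<open>{}\<close>. Boundedness is
  required explicitly because \<^const>\<open>diameter\<close> has no meaningful value on unbounded sets.
\<close>

definition hausdorff_premeasure :: "real \<Rightarrow> real \<Rightarrow> 'a::metric_space set \<Rightarrow> ennreal" where
  "hausdorff_premeasure s \<eta> A =
     (INF U \<in> {U :: nat \<Rightarrow> 'a set. A \<subseteq> (\<Union>n. U n) \<and> (\<forall>n. bounded (U n) \<and> diameter (U n) \<le> \<eta>)}.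
        \<Sum>n. diam_pow s (U n))"

definition hausdorff_measure :: "real \<Rightarrow> 'a::metric_space set \<Rightarrow> ennreal" where
  "hausdorff_measure s A = (SUP \<eta> \<in> {0<..}. hausdorff_premeasure s \<eta> A)"

definition hausdorff_dim :: "'a::metric_space set \<Rightarrow> ereal" where
  "hausdorff_dim A =
     (if A = {} then - \<infinity> else (INF s \<in> {s. 0 \<le> s \<and> hausdorff_measure s A = 0}. ereal s))"

section \<open>Graph directed iterated function systems\<close>

definition edges_between :: "('v, 'e) pre_digraph \<Rightarrow> 'v \<Rightarrow> 'v \<Rightarrow> 'e set" where
  "edges_between G i j = {e \<in> arcs G. tail G e = i \<and> head G e = j}"

text \<open>
  \<open>T e\<close> is only constrained (and only used) for edges \<open>e\<close> of the graph; since \<open>r e > 0\<close>,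
  the data \<open>r e\<close>, \<open>T e\<close>, \<open>v e\<close> are determined by the similarity \<open>S e\<close>.
\<close>

locale gd_ifs = fin_digraph G
  for q :: nat
    and G :: "(nat, 'e) pre_digraph"
    and S :: "'e \<Rightarrow> 'a \<Rightarrow> 'a::euclidean_space"
    and r :: "'e \<Rightarrow> real"
    and T :: "'e \<Rightarrow> 'a \<Rightarrow> 'a"
    and v :: "'e \<Rightarrow> 'a" +
  assumes verts_eq: "verts G = {1..q}"
    and out_arcs_nonempty: "i \<in> verts G \<Longrightarrow> out_arcs G i \<noteq> {}"
    and ratio: "e \<in> arcs G \<Longrightarrow> 0 < r e \<and> r e < 1"
    and orthogonal: "e \<in> arcs G \<Longrightarrow> orthogonal_transformation (T e)"
    and similarity: "e \<in> arcs G \<Longrightarrow> S e x = r e *\<^sub>R T e x + v e"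

text \<open>
  The attractor is the unique tuple with the following property; the values of \<open>K\<close> outside
  the vertex set are irrelevant.
\<close>

definition is_attractor ::
  "('v, 'e) pre_digraph \<Rightarrow> ('e \<Rightarrow> 'a \<Rightarrow> 'a::euclidean_space) \<Rightarrow> ('v \<Rightarrow> 'a set) \<Rightarrow> bool" where
  "is_attractor G S K \<longleftrightarrow>
     (\<forall>i \<in> verts G. compact (K i) \<and> K i \<noteq> {} \<and>
        K i = (\<Union>j \<in> verts G. \<Union>e \<in> edges_between G i j. S e ` K j))"

text \<open>Directed cycles may repeat vertices and edges, so these are closed walks of positive length.\<close>

definition directed_cycles :: "('v, 'e) pre_digraph \<Rightarrow> 'v \<Rightarrow> 'e list set" where
  "directed_cycles G j = {p. pre_digraph.awalk G j p j \<and> length p \<ge> 1}"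

definition orthogonal_group :: "('a::euclidean_space \<Rightarrow> 'a) monoid" where
  "orthogonal_group =
     \<lparr>carrier = {f. orthogonal_transformation f}, mult = (\<circ>), one = id\<rparr>"

lemma group_orthogonal_group: "group (orthogonal_group :: ('a::euclidean_space \<Rightarrow> 'a) monoid)"
proof (rule groupI)
  fix f :: "'a \<Rightarrow> 'a"
  assume "f \<in> carrier orthogonal_group"
  then have f: "orthogonal_transformation f"
    by (simp add: orthogonal_group_def)
  have "orthogonal_transformation (Hilbert_Choice.inv f)" "Hilbert_Choice.inv f \<circ> f = id"
    using orthogonal_transformation_inv[OF f] orthogonal_transformation_inj[OF f]
    by auto
  then show "\<exists>g\<in>carrier orthogonal_group. g \<otimes>\<^bsub>orthogonal_group\<^esub> f = \<one>\<^bsub>orthogonal_group\<^esub>"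
    by (auto simp: orthogonal_group_def)
qed (auto simp: orthogonal_group_def o_assoc id_def
      intro: orthogonal_transformation_compose orthogonal_transformation_id)

definition word_map :: "('e \<Rightarrow> 'a \<Rightarrow> 'a) \<Rightarrow> 'e list \<Rightarrow> 'a \<Rightarrow> 'a" where
  "word_map T p = foldr (\<lambda>e f. T e \<circ> f) p id"

definition transformation_group ::
  "('v, 'e) pre_digraph \<Rightarrow> ('e \<Rightarrow> 'a \<Rightarrow> 'a::euclidean_space) \<Rightarrow> 'v \<Rightarrow> ('a \<Rightarrow> 'a) set" where
  "transformation_group G T j = generate orthogonal_group (word_map T ` directed_cycles G j)"

end

theory Submission
  imports Defs "HOL-Probability.Probability" "HOL-Real_Asymp.Real_Asymp"
begin

text \<open>
  Below any \<open>t < dim K\<^sub>j\<close> there is a subsystem of maps \<open>x \<mapsto> \<rho> x + v\<^sub>i\<close> (\<open>i < N\<close>) of \<open>K\<^sub>j\<close> with disjoint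
  images and \<open>N \<rho>\<^sup>t \<ge> 1\<close>: long words fall into polynomially many classes according to ratio, end
  vertex and rotation, some class contains a large disjoint family, and since the rotation group is
  finite a fixed cycle of bounded length kills the common rotation.

  For such a homogeneous system take the uniform Bernoulli measure on sequences and let \<open>\<delta>\<close> be,
  up to \<open>\<eta>\<close>, the largest exponent for which fibres of dimension at least \<open>\<delta>\<close> have positive measure.
  Almost every fibre then has a finite cover by cylinders of total weight less than one at exponent
  \<open>\<delta> + \<eta>\<close>, and by compactness the cover persists on a ball around the base point. By the maximal
  ergodic inequality, along a set of sequences of positive measure all but a small fraction of the
  orbit admits such covers of uniform size. Substituting covers into covers along the orbit shows
  that the preimage of a set of diameter \<open>\<rho>\<^sup>n\<close> meets only about \<open>\<rho>\<close> to the power \<open>- n (\<delta> + 2 \<eta>)\<close>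
  cylinders of length \<open>n\<close>, so the mass distribution principle bounds the dimension of the set of
  heavy fibres from below. Finally let \<open>t\<close> tend to \<open>dim K\<^sub>j\<close> and pass to a limit point of the \<open>\<delta>\<close>.
\<close>

section \<open>Hausdorff measure and dimension\<close>

lemma hausdorff_measure_mono:
  assumes "A \<subseteq> B"
  shows "hausdorff_measure s A \<le> hausdorff_measure s B"
  unfolding hausdorff_measure_def hausdorff_premeasure_def
  using assms by (intro SUP_mono' INF_superset_mono) auto

lemma hausdorff_premeasure_le_measure:
  assumes "0 < \<eta>"
  shows "hausdorff_premeasure s \<eta> A \<le> hausdorff_measure s A"
  unfolding hausdorff_measure_def using assms by (intro SUP_upper) auto

lemma hausdorff_measure_zero_cover:
  fixes A :: "'a::metric_space set"
  assumes "hausdorff_measure s A = 0" "0 < \<eta>" "0 < e"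
  obtains U :: "nat \<Rightarrow> 'a set" where "A \<subseteq> (\<Union>n. U n)" "\<And>n. bounded (U n)"
    "\<And>n. diameter (U n) \<le> \<eta>" "(\<Sum>n. diam_pow s (U n)) < e"
proof -
  have "hausdorff_premeasure s \<eta> A < e"
    using hausdorff_premeasure_le_measure[OF assms(2), of s A] assms by simp
  then show thesis
    unfolding hausdorff_premeasure_def INF_less_iff using that by blast
qed

lemma hausdorff_premeasure_le_sum:
  fixes V :: "'i \<Rightarrow> 'a::metric_space set"
  assumes "finite F" "A \<subseteq> (\<Union>i\<in>F. V i)"
    and V: "\<And>i. i \<in> F \<Longrightarrow> bounded (V i) \<and> diameter (V i) \<le> \<eta>" and "0 \<le> \<eta>"
  shows "hausdorff_premeasure s \<eta> A \<le> (\<Sum>i\<in>F. diam_pow s (V i))"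
proof -
  obtain h where h: "bij_betw h {..<card F} F"
    using ex_bij_betw_nat_finite[OF assms(1)] by (auto simp: atLeast0LessThan)
  \<comment> \<open>Padding by empty sets turns the finite family into a sequence; their diameter is
    0, within the bound by \<open>0 \<le> \<eta>\<close>, and they weigh nothing.\<close>
  define U where "U n = (if n < card F then V (h n) else {})" for n
  have "A \<subseteq> (\<Union>n. U n)"
  proof
    fix x assume "x \<in> A"
    then obtain i where i: "i \<in> F" "x \<in> V i" using assms(2) by auto
    then obtain n where "n < card F" "h n = i"
      using h unfolding bij_betw_def by (metis imageE lessThan_iff)
    then have "x \<in> U n" using i by (simp add: U_def)
    then show "x \<in> (\<Union>n. U n)" by blast
  qed
  moreover have "bounded (U n) \<and> diameter (U n) \<le> \<eta>" for n
    using V[of "h n"] h assms(4) by (auto simp: U_def bij_betw_def)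
  ultimately have "hausdorff_premeasure s \<eta> A \<le> (\<Sum>n. diam_pow s (U n))"
    unfolding hausdorff_premeasure_def by (intro INF_lower) auto
  also have "\<dots> = (\<Sum>n<card F. diam_pow s (U n))"
    by (rule suminf_finite) (auto simp: U_def diam_pow_def)
  also have "\<dots> = (\<Sum>n<card F. diam_pow s (V (h n)))"
    by (intro sum.cong) (auto simp: U_def)
  also have "\<dots> = (\<Sum>i\<in>F. diam_pow s (V i))"
    by (rule sum.reindex_bij_betw[OF h])
  finally show ?thesis .
qed

text \<open>Strict positivity of \<open>d\<close> is for \<open>s = 0\<close>: a nonempty set then
  weighs 1, while \<open>0 powr 0 = 0\<close>.\<close>

lemma diam_pow_le:
  assumes "bounded U" "diameter U \<le> d" "0 \<le> s" "0 < d"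
  shows "diam_pow s U \<le> ennreal (d powr s)"
  using assms by (auto simp: diam_pow_def intro!: ennreal_leI powr_mono2 diameter_ge_0)

lemma hausdorff_dim_mono:
  assumes "A \<subseteq> B"
  shows "hausdorff_dim A \<le> hausdorff_dim B"
proof (cases "A = {}")
  case False
  then have "B \<noteq> {}" using assms by auto
  have "{s. 0 \<le> s \<and> hausdorff_measure s B = 0} \<subseteq> {s. 0 \<le> s \<and> hausdorff_measure s A = 0}"
    using hausdorff_measure_mono[OF assms] by (metis (mono_tags, lifting) Collect_mono le_zero_eq)
  then show ?thesis
    unfolding hausdorff_dim_def using False \<open>B \<noteq> {}\<close> by (auto intro: INF_superset_mono)
qed (simp add: hausdorff_dim_def)

lemma hausdorff_dim_nonneg:
  assumes "A \<noteq> {}"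
  shows "0 \<le> hausdorff_dim A"
  unfolding hausdorff_dim_def using assms by (auto intro!: INF_greatest)

lemma hausdorff_dim_geI:
  assumes "A \<noteq> {}" "\<And>s. 0 \<le> s \<Longrightarrow> s < \<theta> \<Longrightarrow> hausdorff_measure s A \<noteq> 0"
  shows "ereal \<theta> \<le> hausdorff_dim A"
proof -
  have "ereal \<theta> \<le> ereal s" if "0 \<le> s" "hausdorff_measure s A = 0" for s
    using assms(2)[of s] that by (cases "s < \<theta>") auto
  then show ?thesis
    unfolding hausdorff_dim_def using assms(1) by (auto intro!: INF_greatest)
qed

lemma hausdorff_dim_le:
  assumes "0 \<le> s" "hausdorff_measure s A = 0"
  shows "hausdorff_dim A \<le> ereal s"
proof (cases "A = {}")
  case False
  then show ?thesis
    unfolding hausdorff_dim_def using assms by (auto intro!: INF_lower)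
qed (simp add: hausdorff_dim_def)

lemma hausdorff_dim_lessD:
  assumes "A \<noteq> {}" "hausdorff_dim A < ereal \<theta>"
  obtains s where "0 \<le> s" "s < \<theta>" "hausdorff_measure s A = 0"
  using assms unfolding hausdorff_dim_def by (auto simp: INF_less_iff)

section \<open>Uniform random sequences and the maximal inequality\<close>

text \<open>This is the maximum of the Birkhoff sums of \<open>f\<close> over lengths from 0 to n.
  The recursion peels off the first step, which is the form that Garsia's argument needs.\<close>

primrec max_ergodic_sum :: "('a \<Rightarrow> real) \<Rightarrow> ('a \<Rightarrow> 'a) \<Rightarrow> nat \<Rightarrow> 'a \<Rightarrow> real" where
  "max_ergodic_sum f T 0 = (\<lambda>x. 0)"
| "max_ergodic_sum f T (Suc n) = (\<lambda>x. max 0 (f x + max_ergodic_sum f T n (T x)))"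

lemma max_ergodic_sum_nonneg: "0 \<le> max_ergodic_sum f T n x"
  by (cases n) auto

lemma max_ergodic_sum_le_Suc: "max_ergodic_sum f T n x \<le> max_ergodic_sum f T (Suc n) x"
proof (induction n arbitrary: x)
  case (Suc n)
  have "max 0 (f x + max_ergodic_sum f T n (T x)) \<le> max 0 (f x + max_ergodic_sum f T (Suc n) (T x))"
    using Suc[of "T x"] by (intro max.mono add_left_mono order_refl)
  then show ?case
    by (simp only: max_ergodic_sum.simps(2))
qed auto

lemma max_ergodic_sum_ge: "(\<Sum>k<n. f ((T ^^ k) x)) \<le> max_ergodic_sum f T n x"
proof (induction n arbitrary: x)
  case (Suc n)
  have "(\<Sum>k<Suc n. f ((T ^^ k) x)) = f x + (\<Sum>k<n. f ((T ^^ k) (T x)))"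
    by (simp only: sum.lessThan_Suc_shift funpow_Suc_right o_apply funpow_0)
  then show ?case
    using Suc[of "T x"] by simp
qed simp

lemma max_ergodic_sum_measurable [measurable]:
  assumes [measurable]: "f \<in> borel_measurable M" "T \<in> measurable M M"
  shows "max_ergodic_sum f T n \<in> borel_measurable M"
  by (induction n) auto

lemma max_ergodic_sum_bound:
  assumes "\<And>x. \<bar>f x\<bar> \<le> C"
  shows "\<bar>max_ergodic_sum f T n x\<bar> \<le> real n * C"
proof (induction n arbitrary: x)
  case (Suc n)
  have "f x + max_ergodic_sum f T n (T x) \<le> C + real n * C" "0 \<le> C"
    using Suc[of "T x"] assms[of x] by linarith+
  then show ?case
    by (simp add: algebra_simps max_def)
qed simp

text \<open>Garsia's argument for the maximal ergodic theorem.\<close>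

lemma maximal_frequency_inequality:
  assumes "prob_space M" and T [measurable]: "T \<in> measurable M M" and inv: "distr M M T = M"
    and B [measurable]: "B \<in> sets M" and a: "0 < a" "a \<le> 1"
  obtains E where "E \<in> sets M" "measure M E \<le> measure M B / a"
    "\<And>x n. x \<in> space M - E \<Longrightarrow> real (card {k. k < n \<and> (T ^^ k) x \<in> B}) \<le> a * real n"
proof -
  interpret prob_space M by fact
  define f where "f = (\<lambda>x. indicator B x - a :: real)"
  have [measurable]: "f \<in> borel_measurable M" unfolding f_def by measurable
  define m where "m = max_ergodic_sum f T"
  have m_meas [measurable]: "m n \<in> borel_measurable M" for n unfolding m_def by measurable
  define E where "E n = {x \<in> space M. 0 < m n x}" for n
  have E_meas [measurable]: "E n \<in> sets M" for n unfolding E_def by measurable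
  have fb: "\<bar>f x\<bar> \<le> 1" for x using a by (auto simp: f_def indicator_def)
  have mb: "\<bar>m n x\<bar> \<le> real n * 1" for n x
    unfolding m_def by (rule max_ergodic_sum_bound) (rule fb)
  have int_m: "integrable M (m n)" for n
    by (rule integrable_const_bound[where B = "real n * 1"])
       (use mb in auto)
  have int_mT: "integrable M (\<lambda>x. m n (T x))" for n
    by (rule integrable_const_bound[where B = "real n * 1"])
       (use mb in auto)
  have int_eq: "(\<integral>x. m n (T x) \<partial>M) = (\<integral>x. m n x \<partial>M)" for n
    by (subst (2) inv[symmetric], subst integral_distr) auto
  \<comment> \<open>Where the maximum is positive it equals \<open>f x\<close> plus the maximum of
    one step less at \<open>T x\<close>; elsewhere only \<open>0 \<le> m n (T x)\<close> is claimed.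
    After integration the \<open>m\<close> terms cancel by invariance, leaving a bound on the
    measure of \<open>E n\<close>.\<close>
  have pw: "m n x \<le> (indicator (B \<inter> E n) x - a * indicator (E n) x) + m n (T x)"
    if "x \<in> space M" for n x
  proof (cases "0 < m n x")
    case True
    then obtain k where n: "n = Suc k" by (cases n) (auto simp: m_def)
    have "m n x = f x + m k (T x)" using True by (auto simp: n m_def)
    also have "m k (T x) \<le> m n (T x)" unfolding n m_def by (rule max_ergodic_sum_le_Suc)
    finally show ?thesis using True that by (auto simp: f_def E_def indicator_def)
  next
    case False
    then show ?thesis
      using max_ergodic_sum_nonneg[of f T n "T x"] by (auto simp: E_def m_def)
  qed
  have En: "measure M (E n) \<le> measure M B / a" for n
  proof -
    have "(\<integral>x. m n x \<partial>M) \<le> (\<integral>x. (indicator (B \<inter> E n) x - a * indicator (E n) x) + m n (T x) \<partial>M)"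
      using pw by (intro integral_mono int_m Bochner_Integration.integrable_add int_mT
          Bochner_Integration.integrable_diff integrable_mult_right integrable_real_indicator)
        (auto simp: less_top[symmetric])
    also have "\<dots> = (measure M (B \<inter> E n) - a * measure M (E n)) + (\<integral>x. m n x \<partial>M)"
      using int_mT[of n] int_eq[of n] by (simp add: emeasure_eq_measure)
    finally have "a * measure M (E n) \<le> measure M (B \<inter> E n)" by simp
    also have "\<dots> \<le> measure M B" by (intro finite_measure_mono) auto
    finally show ?thesis using a by (simp add: field_simps)
  qed
  \<comment> \<open>The bound for each \<open>E n\<close> passes to the union, so one exceptional
    set serves all lengths at once.\<close>
  have "incseq E"
    unfolding E_def m_def using max_ergodic_sum_le_Suc
    by (intro incseq_SucI) (fastforce intro: less_le_trans)
  then have "(\<lambda>n. measure M (E n)) \<longlonglongrightarrow> measure M (\<Union>n. E n)"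
    by (intro finite_Lim_measure_incseq) auto
  then have "measure M (\<Union>n. E n) \<le> measure M B / a"
    by (rule LIMSEQ_le_const2) (use En in auto)
  \<comment> \<open>Outside the union every maximum vanishes, so every Birkhoff sum of
    \<open>f\<close> is at most 0; that sum is the number of visits to \<open>B\<close> minus
    \<open>a * n\<close>.\<close>
  moreover have "real (card {k. k < n \<and> (T ^^ k) x \<in> B}) \<le> a * real n"
    if "x \<in> space M - (\<Union>n. E n)" for x n
  proof -
    have "(\<Sum>k<n. f ((T ^^ k) x)) \<le> 0"
      using max_ergodic_sum_ge[of f T x n] that by (auto simp: E_def m_def not_less) (meson order_trans)
    moreover have "(\<Sum>k<n. f ((T ^^ k) x)) = real (card {k. k < n \<and> (T ^^ k) x \<in> B}) - a * real n"
    proof -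
      have "(\<Sum>k<n. indicator B ((T ^^ k) x) :: real) = real (card ({..<n} \<inter> {k. (T ^^ k) x \<in> B}))"
        by (simp add: indicator_def sum.If_cases Int_def if_distrib cong: if_cong)
      also have "{..<n} \<inter> {k. (T ^^ k) x \<in> B} = {k. k < n \<and> (T ^^ k) x \<in> B}" by auto
      finally show ?thesis by (simp add: f_def sum_subtractf mult.commute)
    qed
    ultimately show ?thesis by simp
  qed
  ultimately show thesis by (intro that[of "\<Union>n. E n"]) auto
qed

section \<open>The uniform Bernoulli measure, the shift and cylinders\<close>

definition uniform_sequence_measure :: "nat \<Rightarrow> (nat \<Rightarrow> nat) measure" where
  "uniform_sequence_measure N = PiM UNIV (\<lambda>_. measure_pmf (pmf_of_set {..<N}))"

definition seq_shift :: "nat \<Rightarrow> (nat \<Rightarrow> 'i) \<Rightarrow> nat \<Rightarrow> 'i" where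
  "seq_shift n \<omega> = (\<lambda>k. \<omega> (n + k))"

definition seq_prefix :: "nat \<Rightarrow> (nat \<Rightarrow> 'i) \<Rightarrow> 'i list" where
  "seq_prefix n \<omega> = map \<omega> [0..<n]"

definition cylinder :: "'i list \<Rightarrow> (nat \<Rightarrow> 'i) set" where
  "cylinder w = {\<omega>. \<forall>i<length w. \<omega> i = w ! i}"

lemma seq_prefix_cylinder: "\<omega> \<in> cylinder w \<longleftrightarrow> seq_prefix (length w) \<omega> = w"
proof
  assume "\<omega> \<in> cylinder w"
  then show "seq_prefix (length w) \<omega> = w"
    by (intro nth_equalityI) (simp_all add: cylinder_def seq_prefix_def)
next
  assume eq: "seq_prefix (length w) \<omega> = w"
  have "\<omega> i = w ! i" if "i < length w" for i
    using arg_cong[OF eq, of "\<lambda>u. u ! i"] that by (simp add: seq_prefix_def)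
  then show "\<omega> \<in> cylinder w" by (simp add: cylinder_def)
qed

lemma length_seq_prefix [simp]: "length (seq_prefix n \<omega>) = n"
  by (simp add: seq_prefix_def)

lemma seq_prefix_add: "seq_prefix (m + n) \<omega> = seq_prefix m \<omega> @ seq_prefix n (seq_shift m \<omega>)"
  by (rule nth_equalityI) (auto simp: seq_prefix_def seq_shift_def nth_append)

lemma seq_shift_add [simp]: "seq_shift m (seq_shift n \<omega>) = seq_shift (n + m) \<omega>"
  by (simp add: seq_shift_def add.assoc)

lemma seq_shift_0 [simp]: "seq_shift 0 \<omega> = \<omega>"
  by (simp add: seq_shift_def)

lemma funpow_seq_shift: "(seq_shift 1 ^^ n) \<omega> = seq_shift n \<omega>"
proof (induction n)
  case (Suc n)
  have "(seq_shift 1 ^^ Suc n) \<omega> = seq_shift 1 (seq_shift n \<omega>)"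
    by (simp only: funpow.simps o_apply Suc)
  then show ?case
    by (simp only: seq_shift_add) simp
qed simp

text \<open>Coordinates range over all naturals, so the measurable sets are the Borel sets of the
  full sequence space, and preimages of closed sets under continuous maps become measurable.\<close>

lemma sets_uniform_sequence_measure: "sets (uniform_sequence_measure N) = sets borel"
proof -
  have "sets (uniform_sequence_measure N) = sets (PiM UNIV (\<lambda>_. borel :: nat measure))"
    unfolding uniform_sequence_measure_def
    by (intro sets_PiM_cong) (auto simp: sets_borel_eq_count_space)
  then show ?thesis by (simp add: sets_PiM_equal_borel)
qed

lemma space_uniform_sequence_measure: "space (uniform_sequence_measure N) = UNIV"
  using sets_eq_imp_space_eq[OF sets_uniform_sequence_measure] by simp

lemma prob_space_uniform_sequence_measure: "prob_space (uniform_sequence_measure N)"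
  unfolding uniform_sequence_measure_def by (intro prob_space_PiM measure_pmf.prob_space_axioms)

lemma seq_shift_measurable:
  "seq_shift n \<in> measurable (uniform_sequence_measure N) (uniform_sequence_measure N)"
  unfolding uniform_sequence_measure_def seq_shift_def
  by (rule measurable_PiM_single') (auto simp: space_PiM)

text \<open>The shift selects coordinates along the injection \<open>k \<mapsto> n + k\<close>, and
  all factors of the product are equal.\<close>

lemma distr_seq_shift_uniform_sequence_measure:
  "distr (uniform_sequence_measure N) (uniform_sequence_measure N) (seq_shift n) = uniform_sequence_measure N"
  using distr_PiM_reindex[of UNIV "\<lambda>_. measure_pmf (pmf_of_set {..<N})" "\<lambda>k. n + k" UNIV]
  unfolding uniform_sequence_measure_def seq_shift_def
  by (simp add: measure_pmf.prob_space_axioms restrict_def)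

lemma AE_uniform_sequence_measure:
  assumes "0 < N"
  shows "AE \<omega> in uniform_sequence_measure N. \<forall>k. \<omega> k < N"
proof -
  have "AE \<omega> in uniform_sequence_measure N. \<omega> k < N" for k
    unfolding uniform_sequence_measure_def
    by (rule AE_PiM_component)
       (use assms in \<open>auto simp: measure_pmf.prob_space_axioms AE_measure_pmf_iff lessThan_empty_iff\<close>)
  then show ?thesis by (simp add: AE_all_countable)
qed

text \<open>A cylinder is a finite product of singletons. Only an upper bound is claimed, since a
  letter that is at least \<open>N\<close> has mass 0.\<close>

lemma cylinder_measure:
  assumes "0 < N"
  shows "cylinder w \<in> sets (uniform_sequence_measure N)"
    and "emeasure (uniform_sequence_measure N) (cylinder w) \<le> ennreal ((1 / real N) ^ length w)"
proof -
  let ?M = "\<lambda>_::nat. measure_pmf (pmf_of_set {..<N})"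
  have eq: "cylinder w = prod_emb UNIV ?M {..<length w} (PiE {..<length w} (\<lambda>i. {w ! i}))"
    by (simp add: Ball_def cylinder_def prod_emb_def PiE_iff space_PiM set_eq_iff restrict_def extensional_def)
  show "cylinder w \<in> sets (uniform_sequence_measure N)"
    unfolding eq uniform_sequence_measure_def by (intro sets_PiM_I_finite sets_PiM_I) auto
  have "emeasure (uniform_sequence_measure N) (cylinder w)
      = (\<Prod>i<length w. emeasure (measure_pmf (pmf_of_set {..<N})) {w ! i})"
    unfolding eq uniform_sequence_measure_def
    by (intro emeasure_PiM_emb) (auto simp: measure_pmf.prob_space_axioms)
  also have "\<dots> \<le> (\<Prod>i<length w. ennreal (1 / real N))"
    using assms
    by (intro prod_mono_ennreal)
       (simp_all add: emeasure_pmf_single pmf_of_set lessThan_empty_iff ennreal_leI split: split_indicator)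
  also have "\<dots> = ennreal ((1 / real N) ^ length w)"
    by (simp add: ennreal_power)
  finally show "emeasure (uniform_sequence_measure N) (cylinder w) \<le> ennreal ((1 / real N) ^ length w)" .
qed

section \<open>Coding of homogeneous iterated function systems\<close>

definition sequences_below :: "nat \<Rightarrow> (nat \<Rightarrow> nat) set" where
  "sequences_below N = {\<omega>. \<forall>k. \<omega> k < N}"

lemma compact_sequences_below: "compact (sequences_below N)"
proof -
  have "sequences_below N = PiE UNIV (\<lambda>_. {..<N})"
    by (auto simp: sequences_below_def PiE_iff)
  moreover have "compactin (product_topology (\<lambda>_::nat. euclidean :: nat topology) UNIV) (PiE UNIV (\<lambda>_. {..<N}))"
    by (subst compactin_PiE) (auto intro: finite_imp_compact)
  ultimately show ?thesis
    by (simp add: euclidean_product_topology)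
qed

lemma closed_sequences_below: "closed (sequences_below N)"
proof -
  have "sequences_below N = (\<Inter>k. (\<lambda>\<omega>. \<omega> k) -` {..<N})"
    by (auto simp: sequences_below_def)
  moreover have "closed ((\<lambda>\<omega>::nat \<Rightarrow> nat. \<omega> k) -` {..<N})" for k
    by (intro closed_vimage continuous_on_product_coordinates) (simp add: closed_def Topological_Spaces.open_discrete)
  ultimately show ?thesis by auto
qed

lemma seq_shift_sequences_below: "\<omega> \<in> sequences_below N \<Longrightarrow> seq_shift n \<omega> \<in> sequences_below N"
  by (simp add: sequences_below_def seq_shift_def)

lemma open_cylinder: "open (cylinder w :: (nat \<Rightarrow> nat) set)"
proof -
  have "cylinder w = (\<Inter>i<length w. (\<lambda>\<omega>. \<omega> i) -` {w ! i})"
    by (auto simp: cylinder_def)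
  moreover have "open ((\<lambda>\<omega>::nat \<Rightarrow> nat. \<omega> i) -` {w ! i})" for i
    by (intro open_vimage continuous_on_product_coordinates) (rule Topological_Spaces.open_discrete)
  ultimately show ?thesis by auto
qed

text \<open>All maps share one ratio and have no rotation. The set \<open>X\<close> is only mapped
  into itself, so it may be larger than the attractor of these maps; this allows a subsystem to act
  on a whole \<open>K j\<close>. Through \<open>v_zero\<close> the translations stay bounded, so
  that \<open>code\<close> converges and is continuous on all sequences.\<close>

locale homogeneous_ifs =
  fixes \<rho> :: real and N :: nat and v :: "nat \<Rightarrow> 'a::euclidean_space"
    and X :: "'a set" and L :: "'a \<Rightarrow> 'b::euclidean_space"
  assumes rho: "0 < \<rho>" "\<rho> < 1" and N_pos: "0 < N"
    and v_zero: "\<And>i. N \<le> i \<Longrightarrow> v i = 0"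
    and X: "compact X" "X \<noteq> {}"
    and maps: "\<And>i x. i < N \<Longrightarrow> x \<in> X \<Longrightarrow> \<rho> *\<^sub>R x + v i \<in> X"
    and disj: "\<And>i k x y. i < N \<Longrightarrow> k < N \<Longrightarrow> i \<noteq> k \<Longrightarrow> x \<in> X \<Longrightarrow> y \<in> X \<Longrightarrow>
      \<rho> *\<^sub>R x + v i \<noteq> \<rho> *\<^sub>R y + v k"
    and lin: "linear L"
begin

text \<open>On \<open>sequences_below N\<close> this is the limit of the compositions of the first n
  maps along the sequence, applied to any point of \<open>X\<close>.\<close>

definition code :: "(nat \<Rightarrow> nat) \<Rightarrow> 'a" where
  "code \<omega> = (\<Sum>k. \<rho> ^ k *\<^sub>R v (\<omega> k))"

lemma code_bound: obtains C where "\<And>\<omega> k. norm (\<rho> ^ k *\<^sub>R v (\<omega> k)) \<le> C * \<rho> ^ k"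
proof -
  have "range v \<subseteq> insert 0 (v ` {..<N})" using v_zero by (force simp: not_le[symmetric])
  then have "bounded (range v)" by (meson bounded_subset finite_imp_bounded finite_imageI finite_insert finite_lessThan)
  then obtain C where C: "\<And>i. norm (v i) \<le> C" by (auto simp: bounded_iff)
  have "norm (\<rho> ^ k *\<^sub>R v (\<omega> k)) \<le> C * \<rho> ^ k" for \<omega> k
    using C[of "\<omega> k"] rho by (simp add: mult.commute mult_left_mono)
  then show thesis by (rule that)
qed

lemma summable_code: "summable (\<lambda>k. \<rho> ^ k *\<^sub>R v (\<omega> k))"
proof -
  obtain C where C: "\<And>\<omega> k. norm (\<rho> ^ k *\<^sub>R v (\<omega> k)) \<le> C * \<rho> ^ k" using code_bound by blast
  have "summable (\<lambda>k. C * \<rho> ^ k)" using rho by (intro summable_mult summable_geometric) auto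
  then show ?thesis by (rule summable_comparison_test'[of _ 0]) (rule C)
qed

lemma continuous_code: "continuous_on A code"
proof -
  obtain C where C: "\<And>\<omega> k. norm (\<rho> ^ k *\<^sub>R v (\<omega> k)) \<le> C * \<rho> ^ k" using code_bound by blast
  have "summable (\<lambda>k. C * \<rho> ^ k)" using rho by (intro summable_mult summable_geometric) auto
  then have "uniform_limit UNIV (\<lambda>n \<omega>. \<Sum>k<n. \<rho> ^ k *\<^sub>R v (\<omega> k)) (\<lambda>\<omega>. \<Sum>k. \<rho> ^ k *\<^sub>R v (\<omega> k)) sequentially"
    by (intro Weierstrass_m_test) (rule C)
  moreover have "continuous_on UNIV (\<lambda>\<omega>::nat \<Rightarrow> nat. v (\<omega> k))" for k
    by (rule continuous_on_compose2[of UNIV v]) (auto intro: continuous_on_discrete)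
  ultimately have "continuous_on UNIV code"
    unfolding code_def
    by (intro uniform_limit_theorem[where F = sequentially]) (auto intro!: always_eventually continuous_intros)
  then show ?thesis using continuous_on_subset by blast
qed

lemma code_split: "code \<omega> = (\<Sum>k<n. \<rho> ^ k *\<^sub>R v (\<omega> k)) + \<rho> ^ n *\<^sub>R code (seq_shift n \<omega>)"
proof -
  have "code \<omega> = (\<Sum>k. \<rho> ^ (k + n) *\<^sub>R v (\<omega> (k + n))) + (\<Sum>k<n. \<rho> ^ k *\<^sub>R v (\<omega> k))"
    unfolding code_def by (rule suminf_split_initial_segment[OF summable_code])
  also have "(\<Sum>k. \<rho> ^ (k + n) *\<^sub>R v (\<omega> (k + n))) = (\<Sum>k. \<rho> ^ n *\<^sub>R (\<rho> ^ k *\<^sub>R v (seq_shift n \<omega> k)))"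
    by (simp add: power_add seq_shift_def ac_simps)
  also have "\<dots> = \<rho> ^ n *\<^sub>R code (seq_shift n \<omega>)"
    unfolding code_def by (rule suminf_scaleR_right[symmetric, OF summable_code])
  finally show ?thesis by simp
qed

lemma code_split_first: "code \<omega> = \<rho> *\<^sub>R code (seq_shift 1 \<omega>) + v (\<omega> 0)"
  using code_split[of \<omega> 1] by simp

lemma partial_code_in:
  assumes "\<omega> \<in> sequences_below N" "x \<in> X"
  shows "(\<Sum>k<n. \<rho> ^ k *\<^sub>R v (\<omega> k)) + \<rho> ^ n *\<^sub>R x \<in> X"
  using assms(1)
proof (induction n arbitrary: \<omega>)
  case (Suc n)
  let ?y = "(\<Sum>k<n. \<rho> ^ k *\<^sub>R v (seq_shift 1 \<omega> k)) + \<rho> ^ n *\<^sub>R x"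
  have "\<rho> *\<^sub>R ?y + v (\<omega> 0) \<in> X"
    using Suc.prems seq_shift_sequences_below[OF Suc.prems, of 1]
    by (intro maps Suc.IH) (auto simp: sequences_below_def)
  also have "\<rho> *\<^sub>R ?y + v (\<omega> 0) = (\<Sum>k<Suc n. \<rho> ^ k *\<^sub>R v (\<omega> k)) + \<rho> ^ Suc n *\<^sub>R x"
    by (simp only: sum.lessThan_Suc_shift)
       (simp add: scaleR_add_right scaleR_sum_right seq_shift_def algebra_simps)
  finally show ?case .
qed (use assms in simp)

lemma code_in:
  assumes "\<omega> \<in> sequences_below N"
  shows "code \<omega> \<in> X"
proof -
  obtain x where x: "x \<in> X" using X by auto
  have "(\<lambda>n. \<Sum>k<n. \<rho> ^ k *\<^sub>R v (\<omega> k)) \<longlonglongrightarrow> code \<omega>"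
    unfolding code_def by (rule summable_LIMSEQ[OF summable_code])
  moreover have "(\<lambda>n. \<rho> ^ n *\<^sub>R x) \<longlonglongrightarrow> 0 *\<^sub>R x"
    using rho by (intro tendsto_scaleR LIMSEQ_realpow_zero tendsto_const) auto
  ultimately have "(\<lambda>n. (\<Sum>k<n. \<rho> ^ k *\<^sub>R v (\<omega> k)) + \<rho> ^ n *\<^sub>R x) \<longlonglongrightarrow> code \<omega> + 0 *\<^sub>R x"
    by (rule tendsto_add)
  then have "code \<omega> + 0 *\<^sub>R x \<in> X"
    by (rule Lim_in_closed_set[OF compact_imp_closed[OF X(1)], rotated 2])
       (simp_all add: partial_code_in[OF assms x])
  then show ?thesis by simp
qed

text \<open>The first level images of \<open>X\<close> are finitely many disjoint compact sets,
  hence uniformly apart: codes closer than \<open>c\<close> share their first letter. Removing a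
  common first letter divides distances by \<open>\<rho>\<close>, and induction gives one further
  letter per power of \<open>\<rho>\<close>.\<close>

lemma separation:
  obtains c where "0 < c"
    "\<And>\<omega> \<tau> k. \<omega> \<in> sequences_below N \<Longrightarrow> \<tau> \<in> sequences_below N \<Longrightarrow>
      dist (code \<omega>) (code \<tau>) < c * \<rho> ^ k \<Longrightarrow> seq_prefix (Suc k) \<omega> = seq_prefix (Suc k) \<tau>"
proof -
  define P where "P = {p \<in> {..<N} \<times> {..<N}. fst p \<noteq> snd p}"
  define Y where "Y i = (\<lambda>x. \<rho> *\<^sub>R x + v i) ` X" for i
  have Yc: "compact (Y i)" for i
    unfolding Y_def by (intro compact_continuous_image continuous_intros X(1))
  have "\<forall>p\<in>P. \<exists>d>0. \<forall>x\<in>Y (fst p). \<forall>y\<in>Y (snd p). d \<le> dist x y"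
  proof
    fix p assume p: "p \<in> P"
    have "Y (fst p) \<inter> Y (snd p) = {}"
      using p disj[of "fst p" "snd p"] by (auto simp: P_def Y_def)
    then show "\<exists>d>0. \<forall>x\<in>Y (fst p). \<forall>y\<in>Y (snd p). d \<le> dist x y"
      by (intro separate_compact_closed Yc compact_imp_closed)
  qed
  then obtain d where d: "\<And>p. p \<in> P \<Longrightarrow> 0 < d p"
    "\<And>p x y. p \<in> P \<Longrightarrow> x \<in> Y (fst p) \<Longrightarrow> y \<in> Y (snd p) \<Longrightarrow> d p \<le> dist x y"
    by metis
  have "finite P" unfolding P_def by simp
  \<comment> \<open>The extra 1 keeps the minimum defined when \<open>P\<close> is empty, that is,
    for \<open>N = 1\<close>.\<close>
  define c where "c = Min (insert 1 (d ` P))"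
  have c0: "0 < c" unfolding c_def using \<open>finite P\<close> d(1) by (subst Min_gr_iff) auto
  have cd: "c \<le> d p" if "p \<in> P" for p unfolding c_def using \<open>finite P\<close> that by (intro Min_le) auto
  have first: "\<omega> 0 = \<tau> 0"
    if "\<omega> \<in> sequences_below N" "\<tau> \<in> sequences_below N" "dist (code \<omega>) (code \<tau>) < c" for \<omega> \<tau>
  proof (rule ccontr)
    assume "\<omega> 0 \<noteq> \<tau> 0"
    then have "(\<omega> 0, \<tau> 0) \<in> P" using that by (auto simp: P_def sequences_below_def)
    moreover have "code \<omega> \<in> Y (\<omega> 0)" if "\<omega> \<in> sequences_below N" for \<omega>
      unfolding Y_def by (subst code_split_first) (use code_in seq_shift_sequences_below that in blast)
    ultimately have "c \<le> d (\<omega> 0, \<tau> 0)" "d (\<omega> 0, \<tau> 0) \<le> dist (code \<omega>) (code \<tau>)"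
      using d(2)[of "(\<omega> 0, \<tau> 0)" "code \<omega>" "code \<tau>"] cd that(1,2) by simp_all
    then show False using that by simp
  qed
  have "seq_prefix (Suc k) \<omega> = seq_prefix (Suc k) \<tau>"
    if "\<omega> \<in> sequences_below N" "\<tau> \<in> sequences_below N" "dist (code \<omega>) (code \<tau>) < c * \<rho> ^ k" for \<omega> \<tau> k
    using that
  proof (induction k arbitrary: \<omega> \<tau>)
    case 0
    then show ?case using first[of \<omega> \<tau>] by (simp add: seq_prefix_def)
  next
    case (Suc k)
    have "c * \<rho> ^ Suc k \<le> c * 1" using rho c0 by (intro mult_left_mono power_le_one) auto
    then have eq: "\<omega> 0 = \<tau> 0" using Suc.prems by (intro first) auto
    have "dist (code \<omega>) (code \<tau>) = \<rho> * dist (code (seq_shift 1 \<omega>)) (code (seq_shift 1 \<tau>))"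
      using rho by (simp add: code_split_first[of \<omega>] code_split_first[of \<tau>] eq dist_norm
          flip: scaleR_diff_right)
    then have "dist (code (seq_shift 1 \<omega>)) (code (seq_shift 1 \<tau>)) < c * \<rho> ^ k"
      using Suc.prems(3) rho by (simp add: mult.left_commute)
    then have "seq_prefix (Suc k) (seq_shift 1 \<omega>) = seq_prefix (Suc k) (seq_shift 1 \<tau>)"
      using Suc seq_shift_sequences_below by blast
    moreover have "seq_prefix 1 \<omega> = seq_prefix 1 \<tau>" using eq by (simp add: seq_prefix_def)
    ultimately show ?case
      using seq_prefix_add[of 1 "Suc k" \<omega>] seq_prefix_add[of 1 "Suc k" \<tau>] by simp
  qed
  with c0 show thesis by (rule that)
qed

definition proj :: "(nat \<Rightarrow> nat) \<Rightarrow> 'b" where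
  "proj \<omega> = L (code \<omega>)"

lemma continuous_proj: "continuous_on A proj"
  unfolding proj_def
  by (rule continuous_on_compose2[OF linear_continuous_on[of L UNIV] continuous_code])
     (use lin linear_conv_bounded_linear in auto)

text \<open>The absence of rotations is essential here: the common prefix cancels in the difference
  of codes, and \<open>L\<close> commutes with the remaining scaling. Thus the projection restricted
  to a cylinder is a scaled copy of the whole projection.\<close>

lemma proj_dist:
  assumes "seq_prefix n \<omega> = seq_prefix n \<tau>"
  shows "dist (proj \<omega>) (proj \<tau>) = \<rho> ^ n * dist (proj (seq_shift n \<omega>)) (proj (seq_shift n \<tau>))"
proof -
  have "\<omega> k = \<tau> k" if "k < n" for k
    using assms that by (simp add: seq_prefix_def)
  then have "code \<omega> - code \<tau> = \<rho> ^ n *\<^sub>R (code (seq_shift n \<omega>) - code (seq_shift n \<tau>))"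
    by (simp add: code_split[of \<omega> n] code_split[of \<tau> n] scaleR_diff_right)
  then have "L (code \<omega> - code \<tau>) = \<rho> ^ n *\<^sub>R L (code (seq_shift n \<omega>) - code (seq_shift n \<tau>))"
    by (simp add: linear_scale[OF lin])
  then show ?thesis
    using rho by (simp add: proj_def dist_norm linear_diff[OF lin])
qed

end

section \<open>Covering fibres by cylinders\<close>

lemma ex_geometric_scale:
  fixes \<rho> x :: real
  assumes "0 < \<rho>" "\<rho> < 1" "0 < x" "x < 1"
  obtains k where "\<rho> ^ Suc k \<le> x" "x < \<rho> ^ k"
proof -
  define P where "P k \<longleftrightarrow> \<rho> ^ k \<le> x" for k
  obtain k0 where "\<rho> ^ k0 < x" using real_arch_pow_inv[OF assms(3,2)] by blast
  then have ex: "P k0" by (simp add: P_def)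
  have "\<not> P 0" using assms by (simp add: P_def)
  then obtain k where "\<not> P k" "P (Suc k)"
    using ex by (metis (full_types) LeastI Least_le not0_implies_Suc not_less_eq_eq order_refl)
  then show thesis by (intro that[of k]) (auto simp: P_def)
qed

lemma finite_seq_prefix_image:
  assumes "B \<subseteq> sequences_below N"
  shows "finite (seq_prefix n ` B)" "card (seq_prefix n ` B) \<le> N ^ n"
proof -
  have sub: "seq_prefix n ` B \<subseteq> {u. set u \<subseteq> {..<N} \<and> length u = n}"
    using assms by (force simp: seq_prefix_def sequences_below_def)
  have fin: "finite {u. set u \<subseteq> {..<N} \<and> length u = n}"
    by (rule finite_lists_length_eq) simp
  show "finite (seq_prefix n ` B)" using sub fin by (rule finite_subset)
  show "card (seq_prefix n ` B) \<le> N ^ n"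
    using card_mono[OF fin sub] card_lists_length_eq[of "{..<N}" n] by simp
qed

text \<open>A prefix that starts with \<open>w\<close> is determined by its remaining letters, which
  form a prefix of the shifted sequence.\<close>

lemma card_seq_prefix_le_sum:
  assumes "B \<subseteq> sequences_below N" "finite W" "\<And>w. w \<in> W \<Longrightarrow> length w \<le> n"
    and cov: "\<And>\<omega>. \<omega> \<in> B \<Longrightarrow> \<exists>w\<in>W. \<omega> \<in> cylinder w"
  shows "card (seq_prefix n ` B)
    \<le> (\<Sum>w\<in>W. card (seq_prefix (n - length w) ` seq_shift (length w) ` (B \<inter> cylinder w)))"
proof -
  let ?S = "\<lambda>w. seq_prefix (n - length w) ` seq_shift (length w) ` (B \<inter> cylinder w)"
  have fin: "finite (?S w)" for w
    by (rule finite_seq_prefix_image[of _ N]) (use assms(1) seq_shift_sequences_below in auto)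
  have "seq_prefix n ` B \<subseteq> (\<Union>w\<in>W. (@) w ` ?S w)"
  proof
    fix u assume "u \<in> seq_prefix n ` B"
    then obtain \<omega> where \<omega>: "\<omega> \<in> B" "u = seq_prefix n \<omega>" by auto
    then obtain w where w: "w \<in> W" "\<omega> \<in> cylinder w" using cov by blast
    have "u = w @ seq_prefix (n - length w) (seq_shift (length w) \<omega>)"
      using seq_prefix_add[of "length w" "n - length w" \<omega>] w assms(3)[of w] \<omega>(2)
      by (simp add: seq_prefix_cylinder)
    then show "u \<in> (\<Union>w\<in>W. (@) w ` ?S w)" using w \<omega>(1) by blast
  qed
  then have "card (seq_prefix n ` B) \<le> card (\<Union>w\<in>W. (@) w ` ?S w)"
    using assms(2) fin by (intro card_mono) auto
  also have "\<dots> \<le> (\<Sum>w\<in>W. card ((@) w ` ?S w))" by (rule card_UN_le[OF assms(2)])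
  also have "\<dots> \<le> (\<Sum>w\<in>W. card (?S w))" by (intro sum_mono card_image_le fin)
  finally show ?thesis .
qed

section \<open>Cheap and heavy base points of the projection\<close>

context homogeneous_ifs
begin

text \<open>The s-th power of the contraction ratio of the word, hence up to a constant a bound for
  the cost of its cylinder in an s-dimensional cover.\<close>

definition word_weight :: "real \<Rightarrow> nat list \<Rightarrow> real" where
  "word_weight s w = \<rho> powr (s * real (length w))"

lemma word_weight_nonneg: "0 \<le> word_weight s w"
  by (simp add: word_weight_def)

text \<open>
  Covering the ball of twice the radius makes this set open and increasing in \<open>m\<close>.
\<close>

definition cheap :: "real \<Rightarrow> nat \<Rightarrow> 'b set" where
  "cheap s m = {y. \<exists>z W. dist z y < 1 / 2 ^ m \<and> finite W \<and> (\<forall>w\<in>W. length w \<le> m) \<and>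
     (\<Sum>w\<in>W. word_weight s w) < 1 \<and>
     (\<forall>\<omega>\<in>sequences_below N. dist z (proj \<omega>) < 2 / 2 ^ m \<longrightarrow> (\<exists>w\<in>W. \<omega> \<in> cylinder w))}"

text \<open>Equivalently, the points whose fibre has no finite cover by cylinders of total weight
  below 1: such a cover makes the point cheap by \<open>fiber_cover_imp_cheap\<close>, and a cheap
  point lies in the ball whose preimage its \<open>W\<close> covers.\<close>

definition heavy :: "real \<Rightarrow> 'b set" where
  "heavy s = - (\<Union>m. cheap s m)"

lemma open_cheap: "open (cheap s m)"
proof -
  define Z where "Z = {z. \<exists>W. finite W \<and> (\<forall>w\<in>W. length w \<le> m) \<and> (\<Sum>w\<in>W. word_weight s w) < 1 \<and>
     (\<forall>\<omega>\<in>sequences_below N. dist z (proj \<omega>) < 2 / 2 ^ m \<longrightarrow> (\<exists>w\<in>W. \<omega> \<in> cylinder w))}"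
  have "cheap s m = (\<Union>z\<in>Z. ball z (1 / 2 ^ m))"
    unfolding cheap_def Z_def by (simp only: set_eq_iff mem_Collect_eq UN_iff mem_ball) blast
  then show ?thesis by auto
qed

text \<open>Recentre at the point \<open>y\<close> itself: the ball of radius
  \<open>2 / 2 ^ Suc m\<close> about \<open>y\<close> lies in the ball of radius
  \<open>2 / 2 ^ m\<close> about \<open>z\<close>.\<close>

lemma cheap_mono: "cheap s m \<subseteq> cheap s (Suc m)"
proof
  fix y assume "y \<in> cheap s m"
  then obtain z W where *: "dist z y < 1 / 2 ^ m" "finite W" "\<forall>w\<in>W. length w \<le> m"
    "(\<Sum>w\<in>W. word_weight s w) < 1"
    "\<forall>\<omega>\<in>sequences_below N. dist z (proj \<omega>) < 2 / 2 ^ m \<longrightarrow> (\<exists>w\<in>W. \<omega> \<in> cylinder w)"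
    unfolding cheap_def by blast
  have "\<exists>w\<in>W. \<omega> \<in> cylinder w" if "\<omega> \<in> sequences_below N" "dist y (proj \<omega>) < 2 / 2 ^ Suc m" for \<omega>
  proof -
    have "dist z (proj \<omega>) < 1 / 2 ^ m + 2 / 2 ^ Suc m"
      using *(1) that(2) dist_triangle[of z "proj \<omega>" y] by linarith
    then show ?thesis using *(5) that(1) by simp
  qed
  then show "y \<in> cheap s (Suc m)"
    unfolding cheap_def using *(2-4) le_SucI
    by (intro CollectI exI[of _ y] exI[of _ W]) auto
qed

text \<open>If the diameter of \<open>U\<close> is positive, comparing it with
  \<open>c * \<rho> ^ k\<close> at the right \<open>k\<close> puts all codes in \<open>U\<close>
  into one cylinder of length \<open>Suc k\<close>, whose weight is at most the stated multiple of
  the diameter power. A set of diameter 0 has no such scale; there a cylinder long enough to weigh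
  at most \<open>e\<close> is taken.\<close>

lemma cylinder_containing_small_set:
  assumes sep: "0 < c" "\<And>\<omega> \<tau> k. \<omega> \<in> sequences_below N \<Longrightarrow> \<tau> \<in> sequences_below N \<Longrightarrow>
      dist (code \<omega>) (code \<tau>) < c * \<rho> ^ k \<Longrightarrow> seq_prefix (Suc k) \<omega> = seq_prefix (Suc k) \<tau>"
    and U: "bounded U" "diameter U < c" and s: "0 \<le> s'" "s' < s" and e: "0 < e"
    and \<omega>0: "\<omega>0 \<in> sequences_below N" "code \<omega>0 \<in> U"
  obtains w where "\<And>\<omega>. \<omega> \<in> sequences_below N \<Longrightarrow> code \<omega> \<in> U \<Longrightarrow> \<omega> \<in> cylinder w"
    "word_weight s w \<le> enn2real (diam_pow s' U) / c powr s' + e"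
proof -
  have ne: "U \<noteq> {}" using \<omega>0 by auto
  have cyl: "\<omega> \<in> cylinder (seq_prefix (Suc k) \<omega>0)"
    if k: "diameter U < c * \<rho> ^ k" and \<omega>: "\<omega> \<in> sequences_below N" "code \<omega> \<in> U" for k \<omega>
  proof -
    have "dist (code \<omega>) (code \<omega>0) < c * \<rho> ^ k"
      using diameter_bounded_bound[OF U(1) \<omega>(2) \<omega>0(2)] k by simp
    then have "seq_prefix (Suc k) \<omega> = seq_prefix (Suc k) \<omega>0"
      by (rule sep(2)[OF \<omega>(1) \<omega>0(1)])
    then show "\<omega> \<in> cylinder (seq_prefix (Suc k) \<omega>0)"
      by (simp add: seq_prefix_cylinder)
  qed
  have weight: "word_weight s (seq_prefix k \<omega>0) = (\<rho> ^ k) powr s" for k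
    using rho by (simp add: word_weight_def powr_powr powr_realpow[symmetric] mult.commute)
  show thesis
  proof (cases "diameter U = 0")
    case True
    have less1: "\<rho> powr s < 1" using powr_less_mono2[of s \<rho> 1] rho s by simp
    then obtain k where k: "(\<rho> powr s) ^ k < e"
      using real_arch_pow_inv[OF e] by blast
    have "(\<rho> ^ Suc k) powr s = (\<rho> powr s) ^ Suc k"
      using rho by (simp add: powr_powr powr_realpow[symmetric] mult.commute del: power_Suc)
    also have "\<dots> \<le> (\<rho> powr s) ^ k"
      using less1 by (intro power_decreasing) auto
    finally have "word_weight s (seq_prefix (Suc k) \<omega>0) \<le> e" using k weight by simp
    moreover have "0 \<le> enn2real (diam_pow s' U) / c powr s'" by simp
    ultimately have "word_weight s (seq_prefix (Suc k) \<omega>0) \<le> enn2real (diam_pow s' U) / c powr s' + e"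
      by linarith
    moreover have "diameter U < c * \<rho> ^ k" using True sep(1) rho by simp
    ultimately show thesis using cyl that by blast
  next
    case False
    then have d0: "0 < diameter U" using diameter_ge_0[OF U(1)] by simp
    define x where "x = diameter U / c"
    have x: "0 < x" "x < 1" using d0 sep(1) U(2) by (auto simp: x_def)
    obtain k where k: "\<rho> ^ Suc k \<le> x" "x < \<rho> ^ k" using ex_geometric_scale[OF rho x] by blast
    have "word_weight s (seq_prefix (Suc k) \<omega>0) \<le> x powr s"
      unfolding weight using k(1) rho s by (intro powr_mono2) auto
    also have "\<dots> \<le> x powr s'" using x s by (intro powr_mono') auto
    also have "\<dots> = enn2real (diam_pow s' U) / c powr s'"
      using d0 sep(1) ne by (simp add: x_def diam_pow_def powr_divide)
    finally have "word_weight s (seq_prefix (Suc k) \<omega>0) \<le> enn2real (diam_pow s' U) / c powr s' + e"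
      using e by linarith
    moreover have "diameter U < c * \<rho> ^ k" using k(2) sep(1) by (simp add: x_def field_simps)
    ultimately show thesis using cyl that by blast
  qed
qed

lemma compact_fiber: "compact {\<omega> \<in> sequences_below N. proj \<omega> = y}"
proof -
  have "closed (proj -` {y})"
    by (rule closed_vimage[OF closed_singleton continuous_proj])
  then have "compact (sequences_below N \<inter> proj -` {y})"
    by (rule compact_Int_closed[OF compact_sequences_below])
  moreover have "{\<omega> \<in> sequences_below N. proj \<omega> = y} = sequences_below N \<inter> proj -` {y}" by auto
  ultimately show ?thesis by simp
qed

text \<open>Cylinders are open, so the sequences outside the cover form a compact set whose
  projection misses \<open>y\<close> and stays at a distance \<open>d\<close> from it. Any
  \<open>m\<close> with \<open>2 / 2 ^ m < d\<close> that bounds all word lengths works, with the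
  ball centred at \<open>y\<close>.\<close>

lemma fiber_cover_imp_cheap:
  assumes W: "finite W" "(\<Sum>w\<in>W. word_weight s w) < 1"
    and cov: "{\<omega> \<in> sequences_below N. proj \<omega> = y} \<subseteq> (\<Union>w\<in>W. cylinder w)"
  obtains m where "y \<in> cheap s m"
proof -
  define \<Psi> where "\<Psi> = sequences_below N - (\<Union>w\<in>W. cylinder w)"
  have "compact \<Psi>" unfolding \<Psi>_def
    by (intro compact_diff compact_sequences_below open_UN ballI open_cylinder)
  then have closed: "closed (proj ` \<Psi>)"
    by (rule compact_imp_closed[OF compact_continuous_image[OF continuous_proj]])
  have "y \<notin> proj ` \<Psi>" using cov unfolding \<Psi>_def by blast
  then obtain d where d: "0 < d" "\<forall>x\<in>proj ` \<Psi>. d \<le> dist y x"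
    using separate_point_closed[OF closed] by blast
  have "(1/2::real) < 1" by simp
  then obtain m0 where m0: "(1/2::real) ^ m0 < d / 2"
    using real_arch_pow_inv[OF half_gt_zero[OF d(1)]] by blast
  define m where "m = max m0 (Max (insert 0 (length ` W)))"
  have "(1/2::real) ^ m \<le> (1/2) ^ m0" by (intro power_decreasing) (auto simp: m_def)
  moreover have "2 / 2 ^ m = 2 * (1/2::real) ^ m" by (simp add: power_divide)
  ultimately have md: "2 / 2 ^ m < d" using m0 by linarith
  have len: "length w \<le> m" if "w \<in> W" for w
  proof -
    have "length w \<le> Max (insert 0 (length ` W))"
      using W(1) that by (intro Max_ge) auto
    then show ?thesis by (simp add: m_def)
  qed
  have "\<exists>w\<in>W. \<omega> \<in> cylinder w" if "\<omega> \<in> sequences_below N" "dist y (proj \<omega>) < 2 / 2 ^ m" for \<omega>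
  proof (rule ccontr)
    assume "\<not> (\<exists>w\<in>W. \<omega> \<in> cylinder w)"
    then have "proj \<omega> \<in> proj ` \<Psi>" using that(1) by (auto simp: \<Psi>_def)
    then have "d \<le> dist y (proj \<omega>)" using d(2) by blast
    then show False using that(2) md by linarith
  qed
  then have "y \<in> cheap s m"
    unfolding cheap_def using W len
    by (intro CollectI exI[of _ y] exI[of _ W] conjI ballI impI) simp_all
  then show thesis by (rule that)
qed

text \<open>A fibre of dimension below s has a countable cover of small total weight at some
  \<open>s' < s\<close>. Replacing its sets by cylinders and extracting a finite subcover gives a
  cover of weight below 1, which a heavy point does not admit.\<close>

lemma heavy_fiber_dim:
  assumes y: "y \<in> heavy s" "y \<in> proj ` sequences_below N" and s: "0 \<le> s"
  shows "ereal s \<le> hausdorff_dim (L -` {y} \<inter> X)"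
proof (rule ccontr)
  assume "\<not> ereal s \<le> hausdorff_dim (L -` {y} \<inter> X)"
  then have less: "hausdorff_dim (L -` {y} \<inter> X) < ereal s" by (simp add: not_le)
  have ne: "L -` {y} \<inter> X \<noteq> {}" using y(2) code_in by (auto simp: proj_def)
  obtain s' where s': "0 \<le> s'" "s' < s" "hausdorff_measure s' (L -` {y} \<inter> X) = 0"
    using hausdorff_dim_lessD[OF ne less] .
  define \<Phi> where "\<Phi> = {\<omega> \<in> sequences_below N. proj \<omega> = y}"
  obtain c where c: "0 < c" "\<And>\<omega> \<tau> k. \<omega> \<in> sequences_below N \<Longrightarrow> \<tau> \<in> sequences_below N \<Longrightarrow>
      dist (code \<omega>) (code \<tau>) < c * \<rho> ^ k \<Longrightarrow> seq_prefix (Suc k) \<omega> = seq_prefix (Suc k) \<tau>"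
    using separation by blast
  \<comment> \<open>After division by \<open>c powr s'\<close> the covering sets contribute at most
    1/4, and the errors \<open>(1/2) ^ (n + 2)\<close> at most 1/2, so the total weight stays below
    1.\<close>
  have e0: "0 < ennreal (c powr s' / 4)" using c(1) by simp
  obtain U where U: "L -` {y} \<inter> X \<subseteq> (\<Union>n. U n)" "\<And>n. bounded (U n)" "\<And>n. diameter (U n) \<le> c / 2"
    "(\<Sum>n. diam_pow s' (U n)) < ennreal (c powr s' / 4)"
    by (rule hausdorff_measure_zero_cover[OF s'(3) half_gt_zero[OF c(1)] e0]) blast
  \<comment> \<open>Only sets containing a code of the fibre are kept, because the cylinder is built
    around such a code.\<close>
  define J where "J = {n. \<exists>\<omega>\<in>\<Phi>. code \<omega> \<in> U n}"
  have "\<exists>w. (\<forall>\<omega>\<in>\<Phi>. code \<omega> \<in> U n \<longrightarrow> \<omega> \<in> cylinder w) \<and>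
      word_weight s w \<le> enn2real (diam_pow s' (U n)) / c powr s' + (1/2) ^ (n + 2)"
    if n: "n \<in> J" for n
  proof -
    obtain \<omega>0 where \<omega>0: "\<omega>0 \<in> sequences_below N" "code \<omega>0 \<in> U n"
      using n by (auto simp: J_def \<Phi>_def)
    have small_diam: "diameter (U n) < c" using U(3)[of n] c(1) by linarith
    have pos: "(0::real) < (1/2) ^ (n + 2)" by simp
    obtain w where "\<And>\<omega>. \<omega> \<in> sequences_below N \<Longrightarrow> code \<omega> \<in> U n \<Longrightarrow> \<omega> \<in> cylinder w"
      "word_weight s w \<le> enn2real (diam_pow s' (U n)) / c powr s' + (1/2) ^ (n + 2)"
      using cylinder_containing_small_set[OF c U(2) small_diam s'(1,2) pos \<omega>0] by blast
    then show ?thesis unfolding \<Phi>_def by blast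
  qed
  then have "\<exists>w. \<forall>n\<in>J. (\<forall>\<omega>\<in>\<Phi>. code \<omega> \<in> U n \<longrightarrow> \<omega> \<in> cylinder (w n)) \<and>
      word_weight s (w n) \<le> enn2real (diam_pow s' (U n)) / c powr s' + (1/2) ^ (n + 2)"
    by (intro bchoice ballI)
  then obtain w where w: "\<And>n. n \<in> J \<Longrightarrow> (\<forall>\<omega>\<in>\<Phi>. code \<omega> \<in> U n \<longrightarrow> \<omega> \<in> cylinder (w n)) \<and>
      word_weight s (w n) \<le> enn2real (diam_pow s' (U n)) / c powr s' + (1/2) ^ (n + 2)"
    by blast
  have "\<Phi> \<subseteq> (\<Union>n\<in>J. cylinder (w n))"
  proof
    fix \<omega> assume \<omega>: "\<omega> \<in> \<Phi>"
    then have "code \<omega> \<in> L -` {y} \<inter> X" using code_in by (auto simp: \<Phi>_def proj_def)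
    then obtain n where n: "code \<omega> \<in> U n" using U(1) by blast
    then have "n \<in> J" using \<omega> unfolding J_def by blast
    then show "\<omega> \<in> (\<Union>n\<in>J. cylinder (w n))" using w[of n] \<omega> n by blast
  qed
  then obtain J' where J': "J' \<subseteq> J" "finite J'" "\<Phi> \<subseteq> (\<Union>n\<in>J'. cylinder (w n))"
    by (rule compactE_image[OF compact_fiber[of y, folded \<Phi>_def] open_cylinder]) blast
  define W where "W = w ` J'"
  have "finite W" unfolding W_def using J' by simp
  have "(\<Sum>w\<in>W. word_weight s w) \<le> (\<Sum>n\<in>J'. word_weight s (w n))"
    unfolding W_def using J'(2) sum_image_le[of J' "word_weight s" w] word_weight_nonneg by (simp add: o_def)
  also have "\<dots> \<le> (\<Sum>n\<in>J'. enn2real (diam_pow s' (U n)) / c powr s' + (1/2) ^ (n + 2))"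
    using w J'(1) by (intro sum_mono) blast
  also have "\<dots> = (\<Sum>n\<in>J'. enn2real (diam_pow s' (U n))) / c powr s' + (\<Sum>n\<in>J'. (1/2) ^ (n + 2))"
    by (simp only: sum.distrib sum_divide_distrib)
  also have "\<dots> \<le> (c powr s' / 4) / c powr s' + 1 / 2"
  proof (intro add_mono divide_right_mono)
    have "ennreal (\<Sum>n\<in>J'. enn2real (diam_pow s' (U n))) = (\<Sum>n\<in>J'. diam_pow s' (U n))"
      by (subst sum_ennreal[symmetric]) (auto intro!: sum.cong simp: diam_pow_def)
    also have "\<dots> \<le> (\<Sum>n. diam_pow s' (U n))" by (intro sum_le_suminf J'(2)) auto
    also have "\<dots> \<le> ennreal (c powr s' / 4)" using U(4) by simp
    finally show "(\<Sum>n\<in>J'. enn2real (diam_pow s' (U n))) \<le> c powr s' / 4"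
      by (subst (asm) ennreal_le_iff) auto
    have half: "(\<lambda>n. (1/2::real) ^ n * (1/4)) sums ((1 / (1 - 1/2)) * (1/4))"
      by (intro sums_mult2 geometric_sums) simp
    have "(\<Sum>n\<in>J'. (1/2::real) ^ n * (1/4)) \<le> (1 / (1 - 1/2)) * (1/4)"
      using sum_le_suminf[OF sums_summable[OF half] J'(2)] sums_unique[OF half] by simp
    then show "(\<Sum>n\<in>J'. (1/2::real) ^ (n + 2)) \<le> 1 / 2"
      by (simp add: power_add power2_eq_square)
  qed simp
  also have "\<dots> < 1" using c(1) by simp
  finally have small: "(\<Sum>w\<in>W. word_weight s w) < 1" .
  have "{\<omega> \<in> sequences_below N. proj \<omega> = y} \<subseteq> (\<Union>w\<in>W. cylinder w)"
    using J'(3) unfolding \<Phi>_def W_def by simp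
  then obtain m where "y \<in> cheap s m"
    using fiber_cover_imp_cheap[OF \<open>finite W\<close> small] by blast
  then show False using y(1) by (auto simp: heavy_def)
qed

text \<open>At exponent 0 every word weighs 1, so weight below 1 forces the empty cover, which
  misses the sequence itself.\<close>

lemma proj_in_heavy_zero:
  assumes "\<omega> \<in> sequences_below N"
  shows "proj \<omega> \<in> heavy 0"
proof (rule ccontr)
  assume "proj \<omega> \<notin> heavy 0"
  then obtain m z W where *: "dist z (proj \<omega>) < 1 / 2 ^ m" "finite W" "(\<Sum>w\<in>W. word_weight 0 w) < 1"
    "\<forall>\<omega>\<in>sequences_below N. dist z (proj \<omega>) < 2 / 2 ^ m \<longrightarrow> (\<exists>w\<in>W. \<omega> \<in> cylinder w)"
    unfolding heavy_def cheap_def by blast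
  have "W = {}" using *(2,3) rho by (simp add: word_weight_def)
  moreover have "dist z (proj \<omega>) < 2 / 2 ^ m"
    using *(1) by (rule less_le_trans) (simp add: divide_right_mono)
  ultimately show False using *(4) assms by blast
qed

text \<open>The \<open>N\<close> words of length one cover everything, and their total weight is
  below 1.\<close>

lemma heavy_empty:
  assumes "real N * \<rho> powr s < 1"
  shows "heavy s = {}"
proof -
  have "y \<in> cheap s 1" for y
  proof -
    define W where "W = (\<lambda>i. [i]) ` {..<N}"
    have "(\<Sum>w\<in>W. word_weight s w) = real N * \<rho> powr s"
      unfolding W_def by (subst sum.reindex) (auto simp: inj_on_def word_weight_def)
    moreover have "\<exists>w\<in>W. \<omega> \<in> cylinder w" if "\<omega> \<in> sequences_below N" for \<omega>
      using that by (intro bexI[of _ "[\<omega> 0]"]) (auto simp: W_def cylinder_def sequences_below_def)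
    moreover have "finite W" "\<forall>w\<in>W. length w \<le> 1" by (auto simp: W_def)
    ultimately show ?thesis
      unfolding cheap_def using assms by (intro CollectI exI[of _ y] exI[of _ W]) auto
  qed
  then show ?thesis by (auto simp: heavy_def)
qed

text \<open>Strong induction on n. If some point of the projected set is cheap, one cover
  \<open>W\<close> serves all of \<open>B\<close>; the bounds for the tails, weighted by the words
  of \<open>W\<close>, sum to less than the bound claimed, so nothing is lost. If no point is cheap,
  splitting by the first letter costs a factor \<open>N\<close> and uses up one of the
  \<open>b\<close> permitted bad times. For \<open>n \<le> m\<close> the trivial count
  suffices.\<close>

lemma prefix_count:
  assumes s: "0 \<le> s" and "B \<subseteq> sequences_below N"
    and "\<And>\<omega> \<tau>. \<omega> \<in> B \<Longrightarrow> \<tau> \<in> B \<Longrightarrow> dist (proj \<omega>) (proj \<tau>) \<le> 1 / 2 ^ m * \<rho> ^ n"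
    and "\<And>\<omega>. \<omega> \<in> B \<Longrightarrow> card {k. k < n \<and> proj (seq_shift k \<omega>) \<notin> cheap s m} \<le> b"
  shows "real (card (seq_prefix n ` B)) \<le> real N ^ m * \<rho> powr (- s * real n) * real N ^ b"
  using assms(2-4)
proof (induction n arbitrary: B b rule: less_induct)
  case (less n)
  note prems = less.prems and IH = less.IH
  have N1: "1 \<le> real N ^ k" for k using N_pos by (simp add: Suc_leI)
  \<comment> \<open>The induction hypothesis for the tails after \<open>w\<close>: by
    \<open>proj_dist\<close> removing \<open>w\<close> rescales distances exactly to level
    \<open>n - length w\<close>, and bad times of the tail are bad times of the sequence from
    \<open>length w\<close> on.\<close>
  have shifted: "real (card (seq_prefix (n - length w) ` seq_shift (length w) ` (B \<inter> cylinder w)))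
      \<le> real N ^ m * \<rho> powr (- s * real (n - length w)) * real N ^ b'"
    if w: "w \<noteq> []" "length w \<le> n"
      and b': "\<And>\<omega>. \<omega> \<in> B \<Longrightarrow> card {k. length w \<le> k \<and> k < n \<and> proj (seq_shift k \<omega>) \<notin> cheap s m} \<le> b'"
    for w b'
  proof (rule IH)
    show "n - length w < n" using w by (cases w) auto
    show "seq_shift (length w) ` (B \<inter> cylinder w) \<subseteq> sequences_below N"
      using prems(1) seq_shift_sequences_below by auto
  next
    fix \<omega>' \<tau>' assume "\<omega>' \<in> seq_shift (length w) ` (B \<inter> cylinder w)" "\<tau>' \<in> seq_shift (length w) ` (B \<inter> cylinder w)"
    then obtain \<omega> \<tau> where *: "\<omega> \<in> B" "\<omega> \<in> cylinder w" "\<omega>' = seq_shift (length w) \<omega>"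
      "\<tau> \<in> B" "\<tau> \<in> cylinder w" "\<tau>' = seq_shift (length w) \<tau>" by auto
    have "\<rho> ^ length w * dist (proj \<omega>') (proj \<tau>') = dist (proj \<omega>) (proj \<tau>)"
      using * by (simp add: proj_dist[of "length w"] seq_prefix_cylinder)
    also have "\<dots> \<le> 1 / 2 ^ m * \<rho> ^ n" using * by (intro prems(2))
    also have "\<rho> ^ n = \<rho> ^ length w * \<rho> ^ (n - length w)" using w by (simp flip: power_add)
    finally show "dist (proj \<omega>') (proj \<tau>') \<le> 1 / 2 ^ m * \<rho> ^ (n - length w)"
      using rho by (simp add: field_simps)
  next
    fix \<omega>' assume "\<omega>' \<in> seq_shift (length w) ` (B \<inter> cylinder w)"
    then obtain \<omega> where *: "\<omega> \<in> B" "\<omega>' = seq_shift (length w) \<omega>" by auto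
    have "card {k. k < n - length w \<and> proj (seq_shift k \<omega>') \<notin> cheap s m}
        \<le> card {k. length w \<le> k \<and> k < n \<and> proj (seq_shift k \<omega>) \<notin> cheap s m}"
      by (rule card_inj_on_le[of "\<lambda>k. length w + k"]) (auto simp: * inj_on_def)
    also have "\<dots> \<le> b'" by (rule b') (rule *)
    finally show "card {k. k < n - length w \<and> proj (seq_shift k \<omega>') \<notin> cheap s m} \<le> b'" .
  qed
  have rho_ge: "1 \<le> \<rho> powr (- s * real n)"
    using rho s by (simp add: powr_minus one_le_inverse_iff powr_le1)
  show ?case
  proof (cases "n \<le> m")
    case True
    have "real (card (seq_prefix n ` B)) \<le> real N ^ n"
      using finite_seq_prefix_image(2)[OF prems(1), of n] by (metis of_nat_le_iff of_nat_power)
    also have "\<dots> \<le> real N ^ m" using True N_pos by (intro power_increasing) (auto simp: Suc_leI)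
    also have "\<dots> \<le> real N ^ m * (\<rho> powr (- s * real n) * real N ^ b)"
      using mult_mono[OF rho_ge N1[of b]] N1[of m] by (intro mult_left_le[of _ _, THEN order_trans] mult_le_cancel_left1[THEN iffD2]) auto
    finally show ?thesis by (simp add: mult.assoc)
  next
    case nm: False
    show ?thesis
    proof (cases "\<exists>\<omega>0\<in>B. proj \<omega>0 \<in> cheap s m")
      case True
      then obtain \<omega>0 z W where \<omega>0: "\<omega>0 \<in> B" "dist z (proj \<omega>0) < 1 / 2 ^ m" "finite W"
        "\<forall>w\<in>W. length w \<le> m" "(\<Sum>w\<in>W. word_weight s w) < 1"
        "\<forall>\<omega>\<in>sequences_below N. dist z (proj \<omega>) < 2 / 2 ^ m \<longrightarrow> (\<exists>w\<in>W. \<omega> \<in> cylinder w)"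
        unfolding cheap_def by blast
      \<comment> \<open>All projections of \<open>B\<close> lie within \<open>1 / 2 ^ m\<close> of
        that of \<open>\<omega>0\<close>, hence within twice that of \<open>z\<close>. The doubled
        radius in \<open>cheap\<close> is spent here.\<close>
      have cov: "\<exists>w\<in>W. \<omega> \<in> cylinder w" if "\<omega> \<in> B" for \<omega>
      proof -
        have "1 / 2 ^ m * \<rho> ^ n \<le> 1 / 2 ^ m * 1"
          using rho by (intro mult_left_mono power_le_one) auto
        then have "dist (proj \<omega>0) (proj \<omega>) \<le> 1 / 2 ^ m" using prems(2)[OF \<omega>0(1) that] by simp
        then have "dist z (proj \<omega>) < 1 / 2 ^ m + 1 / 2 ^ m"
          using \<omega>0(2) dist_triangle[of z "proj \<omega>" "proj \<omega>0"] by linarith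
        then show ?thesis using \<omega>0(6) that prems(1) by auto
      qed
      \<comment> \<open>The empty word weighs 1 and would exceed the total weight; so every word of
        \<open>W\<close> shortens the problem.\<close>
      have ne: "w \<noteq> []" if "w \<in> W" for w
      proof
        assume "w = []"
        then have "1 \<le> (\<Sum>w\<in>W. word_weight s w)"
          using member_le_sum[OF that, of "word_weight s"] word_weight_nonneg \<omega>0(3) rho
          by (simp add: word_weight_def)
        then show False using \<omega>0(5) by simp
      qed
      have "real (card (seq_prefix n ` B))
          \<le> real (\<Sum>w\<in>W. card (seq_prefix (n - length w) ` seq_shift (length w) ` (B \<inter> cylinder w)))"
        unfolding of_nat_le_iff
        by (rule card_seq_prefix_le_sum[OF prems(1) \<omega>0(3) _ cov]) (use \<omega>0(4) nm in auto)
      also have "\<dots> \<le> (\<Sum>w\<in>W. real N ^ m * \<rho> powr (- s * real (n - length w)) * real N ^ b)"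
        unfolding of_nat_sum
      proof (intro sum_mono shifted ne)
        fix w assume w: "w \<in> W"
        then show "length w \<le> n" using \<omega>0(4) nm by auto
        fix \<omega> assume "\<omega> \<in> B"
        have "card {k. length w \<le> k \<and> k < n \<and> proj (seq_shift k \<omega>) \<notin> cheap s m}
            \<le> card {k. k < n \<and> proj (seq_shift k \<omega>) \<notin> cheap s m}"
          by (intro card_mono) auto
        then show "card {k. length w \<le> k \<and> k < n \<and> proj (seq_shift k \<omega>) \<notin> cheap s m} \<le> b"
          using prems(3)[OF \<open>\<omega> \<in> B\<close>] by linarith
      qed auto
      also have "\<dots> = (\<Sum>w\<in>W. word_weight s w * (real N ^ m * \<rho> powr (- s * real n) * real N ^ b))"
      proof (intro sum.cong refl)
        fix w assume w: "w \<in> W"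
        then have "- s * real (n - length w) = s * real (length w) + - s * real n"
          using \<omega>0(4) nm by (subst of_nat_diff) (auto simp: algebra_simps)
        then show "real N ^ m * \<rho> powr (- s * real (n - length w)) * real N ^ b
            = word_weight s w * (real N ^ m * \<rho> powr (- s * real n) * real N ^ b)"
          by (simp only: powr_add word_weight_def mult_ac)
      qed
      also have "\<dots> = (\<Sum>w\<in>W. word_weight s w) * (real N ^ m * \<rho> powr (- s * real n) * real N ^ b)"
        by (simp add: sum_distrib_right)
      also have "\<dots> \<le> 1 * (real N ^ m * \<rho> powr (- s * real n) * real N ^ b)"
        using \<omega>0(5) by (intro mult_right_mono) auto
      finally show ?thesis by simp
    next
      case False
      show ?thesis
      proof (cases "B = {}")
        case nB: False
        define W where "W = (\<lambda>i. [i]) ` {..<N}"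
        have cov: "\<exists>w\<in>W. \<omega> \<in> cylinder w" if "\<omega> \<in> B" for \<omega>
          using that prems(1) by (intro bexI[of _ "[\<omega> 0]"]) (auto simp: W_def cylinder_def sequences_below_def)
        \<comment> \<open>Time 0 is bad for every sequence of \<open>B\<close>, so dropping it
          lowers the count of bad times; in particular \<open>b\<close> is positive.\<close>
        have bad: "card {k. 1 \<le> k \<and> k < n \<and> proj (seq_shift k \<omega>) \<notin> cheap s m} < b" if "\<omega> \<in> B" for \<omega>
        proof -
          have "card {k. 1 \<le> k \<and> k < n \<and> proj (seq_shift k \<omega>) \<notin> cheap s m}
              < card {k. k < n \<and> proj (seq_shift k \<omega>) \<notin> cheap s m}"
            using that False nm by (intro psubset_card_mono) (auto intro!: exI[of _ 0])
          then show ?thesis using prems(3)[OF that] by linarith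
        qed
        then have b: "b = Suc (b - 1)" using nB by fastforce
        have finW: "finite W" by (simp add: W_def)
        have cardW: "card W = N" unfolding W_def by (subst card_image) (auto simp: inj_on_def)
        have "real (card (seq_prefix n ` B))
            \<le> real (\<Sum>w\<in>W. card (seq_prefix (n - length w) ` seq_shift (length w) ` (B \<inter> cylinder w)))"
          unfolding of_nat_le_iff
          by (rule card_seq_prefix_le_sum[OF prems(1) finW _ cov]) (use nm in \<open>auto simp: W_def\<close>)
        also have "\<dots> \<le> (\<Sum>w\<in>W. real N ^ m * \<rho> powr (- s * real (n - length w)) * real N ^ (b - 1))"
          unfolding of_nat_sum
        proof (intro sum_mono shifted)
          fix w assume w: "w \<in> W"
          then show "w \<noteq> []" "length w \<le> n" using nm by (auto simp: W_def)
          fix \<omega> assume "\<omega> \<in> B"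
          then show "card {k. length w \<le> k \<and> k < n \<and> proj (seq_shift k \<omega>) \<notin> cheap s m} \<le> b - 1"
            using bad[of \<omega>] w by (auto simp: W_def)
        qed
        also have "\<dots> \<le> (\<Sum>w\<in>W. real N ^ m * \<rho> powr (- s * real n) * real N ^ (b - 1))"
        proof (rule sum_mono)
          fix w
          have "\<rho> powr (- s * real (n - length w)) \<le> \<rho> powr (- s * real n)"
            using rho s by (intro powr_mono') (auto intro: mult_left_mono)
          then show "real N ^ m * \<rho> powr (- s * real (n - length w)) * real N ^ (b - 1)
              \<le> real N ^ m * \<rho> powr (- s * real n) * real N ^ (b - 1)"
            by (intro mult_right_mono mult_left_mono) auto
        qed
        also have "\<dots> = real N ^ m * \<rho> powr (- s * real n) * real N ^ b"
          using b by (simp add: cardW) (metis mult.left_commute power_Suc)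
        finally show ?thesis .
      qed (simp add: zero_le_mult_iff)
    qed
  qed
qed

text \<open>By \<open>prefix_count\<close> with at most \<open>a * n\<close> bad times, the
  sequences in question fill at most a constant times
  \<open>\<rho> powr (- (s + \<eta>) * n)\<close> cylinders, each of measure at most
  \<open>\<rho> powr (t * n)\<close>. The union \<open>Z\<close> of these cylinders is returned
  because the preimage of an arbitrary \<open>U\<close> may fail to be measurable.\<close>

lemma small_preimage_measure:
  assumes A: "A \<subseteq> sequences_below N"
    and freq: "\<And>\<omega> n. \<omega> \<in> A \<Longrightarrow> real (card {k. k < n \<and> proj (seq_shift k \<omega>) \<notin> cheap s m}) \<le> a * real n"
    and s: "0 \<le> s" and a: "0 \<le> a" "real N powr a \<le> \<rho> powr (- \<eta>)"
    and t: "1 \<le> real N * \<rho> powr t"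
    and U: "\<And>x y. x \<in> U \<Longrightarrow> y \<in> U \<Longrightarrow> dist x y \<le> 1 / 2 ^ m * \<rho> ^ n"
  obtains Z where "Z \<in> sets (uniform_sequence_measure N)" "A \<inter> proj -` U \<subseteq> Z"
    "emeasure (uniform_sequence_measure N) Z \<le> ennreal (real N ^ m * (\<rho> ^ n) powr (t - s - \<eta>))"
proof -
  let ?\<mu> = "uniform_sequence_measure N"
  define B where "B = A \<inter> proj -` U"
  define P where "P = seq_prefix n ` B"
  define b where "b = nat \<lfloor>a * real n\<rfloor>"
  have B: "B \<subseteq> sequences_below N" using A by (auto simp: B_def)
  have "real (card P) \<le> real N ^ m * \<rho> powr (- s * real n) * real N ^ b"
    unfolding P_def
  proof (rule prefix_count[OF s B])
    fix \<omega> \<tau> assume "\<omega> \<in> B" "\<tau> \<in> B"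
    then show "dist (proj \<omega>) (proj \<tau>) \<le> 1 / 2 ^ m * \<rho> ^ n"
      unfolding B_def by (intro U) auto
  next
    fix \<omega> assume "\<omega> \<in> B"
    then have "real (card {k. k < n \<and> proj (seq_shift k \<omega>) \<notin> cheap s m}) \<le> a * real n"
      unfolding B_def by (intro freq) auto
    then show "card {k. k < n \<and> proj (seq_shift k \<omega>) \<notin> cheap s m} \<le> b"
      unfolding b_def by (simp add: le_nat_floor)
  qed
  also have "real N ^ b = real N powr real b" using N_pos by (simp add: powr_realpow)
  also have "\<dots> \<le> real N powr (a * real n)"
    using N_pos a(1) by (intro powr_mono) (auto simp: b_def)
  also have "\<dots> = (real N powr a) powr real n" by (simp add: powr_powr)
  also have "\<dots> \<le> (\<rho> powr (- \<eta>)) powr real n" using a(2) by (intro powr_mono2) auto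
  also have "\<dots> = \<rho> powr (- \<eta> * real n)" by (simp add: powr_powr)
  finally have card: "real (card P) \<le> real N ^ m * \<rho> powr (- s * real n) * \<rho> powr (- \<eta> * real n)"
    using N_pos by (simp add: mult_left_mono)
  have "1 / real N \<le> \<rho> powr t" using t N_pos by (simp add: field_simps)
  then have "(1 / real N) ^ n \<le> (\<rho> powr t) ^ n" by (intro power_mono) auto
  also have "\<dots> = \<rho> powr (t * real n)" using rho by (simp add: powr_powr[symmetric] powr_realpow)
  finally have Nn: "(1 / real N) ^ n \<le> \<rho> powr (t * real n)" .
  have "real (card P) * (1 / real N) ^ n
      \<le> (real N ^ m * \<rho> powr (- s * real n) * \<rho> powr (- \<eta> * real n)) * \<rho> powr (t * real n)"
    using card Nn by (intro mult_mono) auto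
  also have "\<dots> = real N ^ m * \<rho> powr (- s * real n + - \<eta> * real n + t * real n)"
    by (simp only: powr_add mult.assoc)
  also have "- s * real n + - \<eta> * real n + t * real n = real n * (t - s - \<eta>)"
    by (simp add: algebra_simps)
  also have "\<rho> powr (real n * (t - s - \<eta>)) = (\<rho> ^ n) powr (t - s - \<eta>)"
    using rho by (simp add: powr_powr[symmetric] powr_realpow)
  finally have bound: "real (card P) * (1 / real N) ^ n \<le> real N ^ m * (\<rho> ^ n) powr (t - s - \<eta>)" .
  define Z where "Z = (\<Union>w\<in>P. cylinder w)"
  have finP: "finite P" unfolding P_def by (rule finite_seq_prefix_image[OF B])
  have len: "length w = n" if "w \<in> P" for w using that by (auto simp: P_def)
  have "Z \<in> sets ?\<mu>" unfolding Z_def using finP cylinder_measure(1)[OF N_pos] by auto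
  moreover have "A \<inter> proj -` U \<subseteq> Z"
  proof
    fix \<omega> assume "\<omega> \<in> A \<inter> proj -` U"
    then have "seq_prefix n \<omega> \<in> P" by (auto simp: P_def B_def)
    moreover have "\<omega> \<in> cylinder (seq_prefix n \<omega>)" by (simp add: seq_prefix_cylinder)
    ultimately show "\<omega> \<in> Z" unfolding Z_def by blast
  qed
  moreover have "emeasure ?\<mu> Z \<le> (\<Sum>w\<in>P. emeasure ?\<mu> (cylinder w))"
    unfolding Z_def using finP cylinder_measure(1)[OF N_pos] by (intro emeasure_subadditive_finite) auto
  then have "emeasure ?\<mu> Z \<le> (\<Sum>w\<in>P. ennreal ((1 / real N) ^ n))"
    using cylinder_measure(2)[OF N_pos] len by (elim order_trans) (intro sum_mono, metis)
  then have "emeasure ?\<mu> Z \<le> ennreal (real (card P) * (1 / real N) ^ n)"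
    by (simp add: ennreal_mult ennreal_of_nat_eq_real_of_nat)
  then have "emeasure ?\<mu> Z \<le> ennreal (real N ^ m * (\<rho> ^ n) powr (t - s - \<eta>))"
    using bound by (elim order_trans) (rule ennreal_leI)
  ultimately show thesis by (rule that)
qed

text \<open>The hypothesis of the mass distribution principle. Choose n so that
  \<open>diameter U * 2 ^ m\<close> lies between consecutive powers of \<open>\<rho>\<close>;
  rounding costs only a constant. For diameter 0, n may be arbitrarily large, and the measure is
  pushed below \<open>e\<close>.\<close>

lemma preimage_measure_le_diam_pow:
  assumes A: "A \<subseteq> sequences_below N"
    and freq: "\<And>\<omega> n. \<omega> \<in> A \<Longrightarrow> real (card {k. k < n \<and> proj (seq_shift k \<omega>) \<notin> cheap s m}) \<le> a * real n"
    and s: "0 \<le> s" and a: "0 \<le> a" "real N powr a \<le> \<rho> powr (- \<eta>)"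
    and t: "1 \<le> real N * \<rho> powr t" and \<sigma>: "0 \<le> \<sigma>" "\<sigma> < t - s - \<eta>"
    and U: "bounded U" "diameter U < 1 / 2 ^ m" and e: "0 < e"
  shows "\<exists>Z. Z \<in> sets (uniform_sequence_measure N) \<and> A \<inter> proj -` U \<subseteq> Z \<and>
    emeasure (uniform_sequence_measure N) Z
      \<le> ennreal (real N ^ m / (\<rho> / 2 ^ m) powr \<sigma>) * diam_pow \<sigma> U + ennreal e"
proof (cases "U = {}")
  case True
  then show ?thesis by (intro exI[of _ "{}"]) auto
next
  case ne: False
  define \<theta> where "\<theta> = t - s - \<eta>"
  show ?thesis
  proof (cases "diameter U = 0")
    case True
    have "\<rho> powr \<theta> < 1" using powr_less_mono2[of \<theta> \<rho> 1] rho \<sigma> by (simp add: \<theta>_def)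
    moreover have "0 < e / real N ^ m" using e N_pos by simp
    ultimately obtain n where n: "(\<rho> powr \<theta>) ^ n < e / real N ^ m"
      using real_arch_pow_inv by blast
    have "dist x y \<le> 1 / 2 ^ m * \<rho> ^ n" if "x \<in> U" "y \<in> U" for x y
    proof -
      have "dist x y \<le> 0" using diameter_bounded_bound[OF U(1) that] True by simp
      also have "0 \<le> 1 / 2 ^ m * \<rho> ^ n" using rho by simp
      finally show ?thesis .
    qed
    then obtain Z where Z: "Z \<in> sets (uniform_sequence_measure N)" "A \<inter> proj -` U \<subseteq> Z"
      "emeasure (uniform_sequence_measure N) Z \<le> ennreal (real N ^ m * (\<rho> ^ n) powr (t - s - \<eta>))"
      using small_preimage_measure[OF A freq s a t, of U n] by blast
    have "(\<rho> ^ n) powr \<theta> = (\<rho> powr \<theta>) ^ n"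
      using rho by (simp add: powr_powr powr_realpow[symmetric] mult.commute)
    then have "real N ^ m * (\<rho> ^ n) powr (t - s - \<eta>) \<le> e"
      using n N_pos by (simp add: \<theta>_def field_simps)
    then have "emeasure (uniform_sequence_measure N) Z \<le> ennreal e"
      using Z(3) by (meson ennreal_leI order_trans)
    also have "\<dots> \<le> ennreal (real N ^ m / (\<rho> / 2 ^ m) powr \<sigma>) * diam_pow \<sigma> U + ennreal e"
      by simp
    finally show ?thesis using Z(1,2) by blast
  next
    case False
    then have d0: "0 < diameter U" using diameter_ge_0[OF U(1)] by simp
    define x where "x = diameter U * 2 ^ m"
    have x: "0 < x" "x < 1" using d0 U(2) by (auto simp: x_def field_simps)
    obtain n where n: "\<rho> ^ Suc n \<le> x" "x < \<rho> ^ n" using ex_geometric_scale[OF rho x] by blast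
    have "dist x' y \<le> 1 / 2 ^ m * \<rho> ^ n" if "x' \<in> U" "y \<in> U" for x' y
    proof -
      have "dist x' y \<le> diameter U" by (rule diameter_bounded_bound[OF U(1) that])
      also have "\<dots> \<le> 1 / 2 ^ m * \<rho> ^ n" using n(2) by (simp add: x_def field_simps)
      finally show ?thesis .
    qed
    then obtain Z where Z: "Z \<in> sets (uniform_sequence_measure N)" "A \<inter> proj -` U \<subseteq> Z"
      "emeasure (uniform_sequence_measure N) Z \<le> ennreal (real N ^ m * (\<rho> ^ n) powr (t - s - \<eta>))"
      using small_preimage_measure[OF A freq s a t, of U n] by blast
    have "(\<rho> ^ n) powr (t - s - \<eta>) \<le> (\<rho> ^ n) powr \<sigma>"
      using rho \<sigma> by (intro powr_mono') (auto intro: power_le_one)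
    also have "\<dots> \<le> (x / \<rho>) powr \<sigma>"
      using n(1) rho \<sigma> by (intro powr_mono2) (auto simp: field_simps)
    also have "x / \<rho> = diameter U / (\<rho> / 2 ^ m)" by (simp add: x_def)
    also have "\<dots> powr \<sigma> = diameter U powr \<sigma> / (\<rho> / 2 ^ m) powr \<sigma>"
      by (rule powr_divide)
    finally have "real N ^ m * (\<rho> ^ n) powr (t - s - \<eta>)
        \<le> real N ^ m * (diameter U powr \<sigma> / (\<rho> / 2 ^ m) powr \<sigma>)"
      by (intro mult_left_mono) auto
    then have "ennreal (real N ^ m * (\<rho> ^ n) powr (t - s - \<eta>))
        \<le> ennreal (real N ^ m / (\<rho> / 2 ^ m) powr \<sigma> * diameter U powr \<sigma>)"
      by (intro ennreal_leI) simp
    also have "\<dots> = ennreal (real N ^ m / (\<rho> / 2 ^ m) powr \<sigma>) * diam_pow \<sigma> U"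
      using d0 ne by (subst ennreal_mult) (auto simp: diam_pow_def)
    also have "\<dots> \<le> \<dots> + ennreal e" by simp
    finally show ?thesis using Z by (meson order_trans)
  qed
qed

text \<open>The exponent is a multiple of \<open>\<eta>\<close> such that heaviness has positive
  probability there and probability 0 one step later. Positivity supplies fibres of dimension at
  least \<open>\<delta>\<close>; the null set supplies cheap covers at almost every point. One
  \<open>\<eta>\<close> is lost to the step of this grid and one to the bad times.\<close>

theorem dimension_conservation:
  assumes t: "1 \<le> real N * \<rho> powr t" and \<eta>: "0 < \<eta>"
  obtains \<delta> where "0 \<le> \<delta>" "{y \<in> L ` X. ereal \<delta> \<le> hausdorff_dim (L -` {y} \<inter> X)} \<noteq> {}"
    "ereal (t - \<delta> - 2 * \<eta>) \<le> hausdorff_dim {y \<in> L ` X. ereal \<delta> \<le> hausdorff_dim (L -` {y} \<inter> X)}"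
proof -
  let ?\<mu> = "uniform_sequence_measure N"
  interpret prob_space ?\<mu> by (rule prob_space_uniform_sequence_measure)
  note sets_\<mu> = sets_uniform_sequence_measure[of N]
  have closed_heavy: "closed (proj -` heavy s)" for s
    unfolding heavy_def using open_cheap
    by (intro closed_vimage[OF _ continuous_proj] closed_Compl) auto
  then have heavy_sets: "proj -` heavy s \<in> sets ?\<mu>" for s unfolding sets_\<mu> by (rule borel_closed)
  have below_sets: "sequences_below N \<in> sets ?\<mu>"
    unfolding sets_\<mu> by (rule borel_closed[OF closed_sequences_below])
  have AE_below: "AE \<omega> in ?\<mu>. \<omega> \<in> sequences_below N"
    using AE_uniform_sequence_measure[OF N_pos] by (simp add: sequences_below_def)
  define p where "p k = prob (proj -` heavy (real k * \<eta>))" for k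
  have "prob (proj -` heavy 0) = 1"
    using AE_below proj_in_heavy_zero by (subst prob_eq_1[OF heavy_sets]) (auto elim!: eventually_mono)
  then have p0: "p 0 \<noteq> 0" by (simp add: p_def)
  have "\<exists>k. p k = 0"
  proof -
    have "\<rho> powr \<eta> < 1" using powr_less_mono2[of \<eta> \<rho> 1] rho \<eta> by simp
    moreover have "0 < 1 / real N" using N_pos by simp
    ultimately obtain k where k: "(\<rho> powr \<eta>) ^ k < 1 / real N"
      using real_arch_pow_inv by blast
    have "\<rho> powr (real k * \<eta>) = (\<rho> powr \<eta>) ^ k"
      using rho by (simp add: powr_powr powr_realpow[symmetric] mult.commute)
    then have "heavy (real k * \<eta>) = {}"
      using k N_pos by (intro heavy_empty) (simp add: field_simps)
    then show ?thesis by (intro exI[of _ k]) (simp add: p_def)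
  qed
  then have "\<exists>k. p k \<noteq> 0 \<and> p (Suc k) = 0"
  proof (rule contrapos_pp)
    assume *: "\<not> (\<exists>k. p k \<noteq> 0 \<and> p (Suc k) = 0)"
    have "p k \<noteq> 0" for k by (induction k) (use p0 * in auto)
    then show "\<not> (\<exists>k. p k = 0)" by simp
  qed
  then obtain k where k: "p k \<noteq> 0" "p (Suc k) = 0" by blast
  define \<delta> where "\<delta> = real k * \<eta>"
  define s where "s = \<delta> + \<eta>"
  have \<delta>0: "0 \<le> \<delta>" and s0: "0 \<le> s" using \<eta> by (simp_all add: \<delta>_def s_def)
  have p\<delta>: "0 < prob (proj -` heavy \<delta>)"
    using k(1) by (simp add: p_def \<delta>_def zero_less_measure_iff)
  have ps: "prob (proj -` heavy s) = 0"
    using k(2) by (simp add: p_def \<delta>_def s_def algebra_simps)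
  \<comment> \<open>The frequency of bad times is so small that
    \<open>real N powr a \<le> \<rho> powr (- \<eta>)\<close>. Adding 1 in the denominator covers
    \<open>N = 1\<close>, where the logarithm is 0.\<close>
  define a where "a = min 1 (\<eta> * ln (1 / \<rho>) / (ln (real N) + 1))"
  have lnN: "0 \<le> ln (real N)" using N_pos by simp
  have ln\<rho>: "0 < ln (1 / \<rho>)" using rho by simp
  have a: "0 < a" "a \<le> 1"
    using \<eta> lnN ln\<rho> by (auto simp: a_def intro!: divide_pos_pos mult_pos_pos)
  have "a * ln (real N) \<le> a * (ln (real N) + 1)" using a by simp
  also have "\<dots> \<le> \<eta> * ln (1 / \<rho>) / (ln (real N) + 1) * (ln (real N) + 1)"
    using lnN by (intro mult_right_mono) (auto simp: a_def)
  also have "\<dots> = - \<eta> * ln \<rho>" using lnN rho by (simp add: ln_div)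
  finally have aN: "real N powr a \<le> \<rho> powr (- \<eta>)"
    using N_pos rho by (simp add: powr_def)
  define Bad where "Bad m = proj -` (- cheap s m)" for m
  have Bad_sets: "Bad m \<in> sets ?\<mu>" for m
    unfolding Bad_def sets_\<mu> using open_cheap
    by (intro borel_closed closed_vimage[OF _ continuous_proj] closed_Compl)
  \<comment> \<open>The bad sets decrease to the null set of points heavy at \<open>s\<close>, so
    some \<open>m\<close> makes \<open>Bad m\<close> rarer than \<open>a\<close> times the
    probability of being heavy at \<open>\<delta>\<close>. The exceptional set of the maximal
    inequality then cannot exhaust the latter.\<close>
  have "decseq Bad"
    unfolding Bad_def using cheap_mono by (intro decseq_SucI) auto
  then have "(\<lambda>m. prob (Bad m)) \<longlonglongrightarrow> prob (\<Inter>m. Bad m)"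
    using Bad_sets by (intro finite_Lim_measure_decseq) auto
  moreover have "(\<Inter>m. Bad m) = proj -` heavy s" by (auto simp: Bad_def heavy_def)
  ultimately have "(\<lambda>m. prob (Bad m)) \<longlonglongrightarrow> 0" using ps by simp
  then have "\<forall>\<^sub>F m in sequentially. prob (Bad m) < a * prob (proj -` heavy \<delta>)"
    using a(1) p\<delta> by (intro order_tendstoD(2)) auto
  then obtain m where m: "prob (Bad m) < a * prob (proj -` heavy \<delta>)"
    using eventually_happens by force
  obtain E where E: "E \<in> sets ?\<mu>" "prob E \<le> prob (Bad m) / a"
    "\<And>\<omega> n. \<omega> \<in> space ?\<mu> - E \<Longrightarrow> real (card {k. k < n \<and> (seq_shift 1 ^^ k) \<omega> \<in> Bad m}) \<le> a * real n"
    by (rule maximal_frequency_inequality[OF prob_space_axioms seq_shift_measurable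
          distr_seq_shift_uniform_sequence_measure Bad_sets a]) blast
  define A where "A = (proj -` heavy \<delta> \<inter> sequences_below N) - E"
  have A_sets: "A \<in> sets ?\<mu>" unfolding A_def using heavy_sets below_sets E(1) by auto
  have "prob (proj -` heavy \<delta>) = prob (proj -` heavy \<delta> \<inter> sequences_below N)"
    using AE_below heavy_sets below_sets
    by (intro finite_measure_eq_AE) (auto elim!: eventually_mono)
  also have "\<dots> \<le> prob (A \<union> E)"
    using sets.Un[OF A_sets E(1)] by (intro finite_measure_mono) (auto simp: A_def)
  also have "\<dots> \<le> prob A + prob E" using A_sets E(1) by (rule measure_Un_le)
  finally have "prob (proj -` heavy \<delta>) \<le> prob A + prob E" .
  moreover have "prob (Bad m) / a < prob (proj -` heavy \<delta>)" using m a(1) by (simp add: field_simps)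
  ultimately have pA: "0 < prob A" using E(2) by linarith
  have A_below: "A \<subseteq> sequences_below N" by (auto simp: A_def)
  have freq: "real (card {k. k < n \<and> proj (seq_shift k \<omega>) \<notin> cheap s m}) \<le> a * real n"
    if "\<omega> \<in> A" for \<omega> n
    using E(3)[of \<omega> n] that
    by (simp add: A_def space_uniform_sequence_measure funpow_seq_shift[unfolded One_nat_def] Bad_def)
  let ?Y = "{y \<in> L ` X. ereal \<delta> \<le> hausdorff_dim (L -` {y} \<inter> X)}"
  have projA: "proj ` A \<subseteq> ?Y"
  proof
    fix y assume "y \<in> proj ` A"
    then obtain \<omega> where \<omega>: "\<omega> \<in> sequences_below N" "proj \<omega> \<in> heavy \<delta>" "y = proj \<omega>"
      by (auto simp: A_def)
    have "y \<in> L ` X" using \<omega> code_in by (auto simp: proj_def)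
    moreover have "ereal \<delta> \<le> hausdorff_dim (L -` {y} \<inter> X)"
      using \<omega> by (intro heavy_fiber_dim \<delta>0) auto
    ultimately show "y \<in> ?Y" by simp
  qed
  have "A \<noteq> {}" using pA by auto
  then have Y_ne: "?Y \<noteq> {}" using projA by blast
  have "ereal (t - \<delta> - 2 * \<eta>) \<le> hausdorff_dim ?Y"
  proof (rule hausdorff_dim_geI[OF Y_ne])
    fix \<sigma> assume \<sigma>: "0 \<le> \<sigma>" "\<sigma> < t - \<delta> - 2 * \<eta>"
    then have \<sigma>': "\<sigma> < t - s - \<eta>" by (simp add: s_def)
    show "hausdorff_measure \<sigma> ?Y \<noteq> 0"
    proof
      assume zero: "hausdorff_measure \<sigma> ?Y = 0"
      define C where "C = real N ^ m / (\<rho> / 2 ^ m) powr \<sigma>"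
      have C: "0 < C" using N_pos rho by (simp add: C_def)
      \<comment> \<open>With this total weight the main terms contribute less than
        \<open>prob A / 2\<close>, and the errors \<open>prob A / 4 * (1/2) ^ n\<close> add up to
        \<open>prob A / 2\<close>: a contradiction. \<open>Suc m\<close> makes the diameter bound
        strict.\<close>
      have "0 < 1 / (2::real) ^ Suc m" "0 < ennreal (prob A / (2 * C))" using pA C by simp_all
      then obtain U where U: "?Y \<subseteq> (\<Union>n. U n)" "\<And>n. bounded (U n)" "\<And>n. diameter (U n) \<le> 1 / 2 ^ Suc m"
        "(\<Sum>n. diam_pow \<sigma> (U n)) < ennreal (prob A / (2 * C))"
        by (rule hausdorff_measure_zero_cover[OF zero]) blast
      have "\<exists>Z. Z \<in> sets ?\<mu> \<and> A \<inter> proj -` U n \<subseteq> Z \<and>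
          emeasure ?\<mu> Z \<le> ennreal C * diam_pow \<sigma> (U n) + ennreal (prob A / 4 * (1/2) ^ n)" for n
        unfolding C_def
      proof (rule preimage_measure_le_diam_pow[OF A_below freq s0 _ aN t \<sigma>(1) \<sigma>' U(2)])
        have "1 / 2 ^ Suc m < (1::real) / 2 ^ m" by (simp add: field_simps)
        then show "diameter (U n) < 1 / 2 ^ m" using U(3)[of n] by linarith
      qed (use a pA in auto)
      then have "\<exists>Z. \<forall>n. Z n \<in> sets ?\<mu> \<and> A \<inter> proj -` U n \<subseteq> Z n \<and>
          emeasure ?\<mu> (Z n) \<le> ennreal C * diam_pow \<sigma> (U n) + ennreal (prob A / 4 * (1/2) ^ n)"
        by (intro choice allI)
      then obtain Z where Z: "\<And>n. Z n \<in> sets ?\<mu>" "\<And>n. A \<inter> proj -` U n \<subseteq> Z n"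
        "\<And>n. emeasure ?\<mu> (Z n) \<le> ennreal C * diam_pow \<sigma> (U n) + ennreal (prob A / 4 * (1/2) ^ n)"
        by blast
      have "A \<subseteq> (\<Union>n. Z n)"
      proof
        fix \<omega> assume \<omega>: "\<omega> \<in> A"
        then have "proj \<omega> \<in> (\<Union>n. U n)" using projA U(1) by blast
        then show "\<omega> \<in> (\<Union>n. Z n)" using Z(2) \<omega> by blast
      qed
      then have "emeasure ?\<mu> A \<le> emeasure ?\<mu> (\<Union>n. Z n)" using Z(1) by (intro emeasure_mono) auto
      also have "\<dots> \<le> (\<Sum>n. emeasure ?\<mu> (Z n))" using Z(1) by (intro emeasure_subadditive_countably) auto
      also have "\<dots> \<le> (\<Sum>n. ennreal C * diam_pow \<sigma> (U n) + ennreal (prob A / 4 * (1/2) ^ n))"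
        using Z(3) by (intro suminf_le) auto
      also have "\<dots> = ennreal C * (\<Sum>n. diam_pow \<sigma> (U n)) + (\<Sum>n. ennreal (prob A / 4 * (1/2) ^ n))"
        by (simp add: suminf_add[symmetric] ennreal_suminf_cmult)
      also have "(\<Sum>n. ennreal (prob A / 4 * (1/2) ^ n)) = ennreal (prob A / 2)"
      proof -
        have "(\<lambda>n. prob A / 4 * (1/2) ^ n) sums (prob A / 4 * (1 / (1 - 1/2)))"
          by (intro sums_mult geometric_sums) simp
        then show ?thesis by (subst suminf_ennreal_eq) auto
      qed
      also have "ennreal C * (\<Sum>n. diam_pow \<sigma> (U n)) + ennreal (prob A / 2)
          < ennreal C * ennreal (prob A / (2 * C)) + ennreal (prob A / 2)"
      proof -
        have "ennreal C * (\<Sum>n. diam_pow \<sigma> (U n)) < ennreal C * ennreal (prob A / (2 * C))"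
          using U(4) C by (intro ennreal_mult_strict_left_mono) auto
        then show ?thesis by (simp add: ennreal_add_left_cancel_less add.commute)
      qed
      also have "\<dots> = ennreal (prob A)"
        using C pA by (simp add: ennreal_mult[symmetric] ennreal_plus[symmetric] del: ennreal_plus)
      finally show False by (simp add: emeasure_eq_measure)
    qed
  qed
  with \<delta>0 Y_ne show thesis by (rule that)
qed

end

section \<open>Words of graph directed systems\<close>

text \<open>Greedy choice: a set is added exactly when it is nonempty and meets none chosen
  before.\<close>

lemma maximal_disjoint_subfamily:
  assumes "finite C"
  obtains F where "F \<subseteq> C" "\<And>p p'. p \<in> F \<Longrightarrow> p' \<in> F \<Longrightarrow> p \<noteq> p' \<Longrightarrow> V p \<inter> V p' = {}"
    "\<And>p. p \<in> C \<Longrightarrow> V p \<noteq> {} \<Longrightarrow> \<exists>p'\<in>F. V p \<inter> V p' \<noteq> {}"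
proof -
  define meets where "meets p F \<longleftrightarrow> (\<exists>p'\<in>F. V p \<inter> V p' \<noteq> {})" for p F
  have "\<exists>F. F \<subseteq> C \<and> disjoint_family_on V F \<and> (\<forall>p\<in>C. V p \<noteq> {} \<longrightarrow> meets p F)"
    using assms
  proof induction
    case empty
    then show ?case by (simp add: disjoint_family_on_def)
  next
    case (insert x C)
    from insert.IH obtain F where F: "F \<subseteq> C" "disjoint_family_on V F"
      "\<forall>p\<in>C. V p \<noteq> {} \<longrightarrow> meets p F" by (elim exE conjE)
    show ?case
    proof (cases "V x = {} \<or> meets x F")
      case True
      have "\<forall>p\<in>insert x C. V p \<noteq> {} \<longrightarrow> meets p F" using True F(3) by auto
      then show ?thesis using F(1,2) by (intro exI[of _ F] conjI) auto
    next
      case False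
      have "\<forall>p\<in>insert x C. V p \<noteq> {} \<longrightarrow> meets p (insert x F)"
        using F(3) by (simp add: meets_def)
      moreover have "disjoint_family_on V (insert x F)"
        using F(2) False unfolding disjoint_family_on_def meets_def by (simp add: Int_commute)
      ultimately show ?thesis using F(1) by (intro exI[of _ "insert x F"] conjI) auto
    qed
  qed
  then show thesis by (elim exE conjE) (rule that, auto simp: disjoint_family_on_def meets_def)
qed

text \<open>Hence the ratio of a word depends only on how often each edge occurs, which leaves at
  most \<open>(n + 1) ^ card (arcs G)\<close> cases for length n.\<close>

lemma prod_list_eq_prod_count_list:
  fixes f :: "'e \<Rightarrow> 'r::comm_monoid_mult"
  assumes "finite A" "set p \<subseteq> A"
  shows "prod_list (map f p) = (\<Prod>e\<in>A. f e ^ count_list p e)"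
  using assms(2)
proof (induction p)
  case (Cons x p)
  have "(\<Prod>e\<in>A. f e ^ count_list (x # p) e) = (\<Prod>e\<in>A. (if e = x then f x else 1) * f e ^ count_list p e)"
    by (intro prod.cong) auto
  also have "\<dots> = f x * (\<Prod>e\<in>A. f e ^ count_list p e)"
    using Cons.prems assms(1) by (simp add: prod.distrib)
  finally show ?case using Cons by simp
qed simp

lemma power_mult_exp_tendsto_0:
  fixes x :: real
  assumes "0 < x" "x < 1"
  shows "(\<lambda>n. (real n + 1) ^ k * x ^ n) \<longlonglongrightarrow> 0"
proof -
  define c where "c = - ln x"
  have c: "0 < c" using assms by (simp add: c_def)
  have xn: "x ^ n = exp (- (c * real n))" for n
    using assms by (simp add: c_def exp_of_nat2_mult)
  have "filterlim (\<lambda>n. c * (real n + 1)) at_top sequentially"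
    using c by real_asymp
  then have "(\<lambda>n. (c * (real n + 1)) ^ k / exp (c * (real n + 1))) \<longlonglongrightarrow> 0"
    by (rule filterlim_compose[OF tendsto_power_div_exp_0])
  then have "(\<lambda>n. exp c / c ^ k * ((c * (real n + 1)) ^ k / exp (c * (real n + 1)))) \<longlonglongrightarrow> exp c / c ^ k * 0"
    by (rule tendsto_mult_left)
  moreover have "exp c / c ^ k * ((c * (real n + 1)) ^ k / exp (c * (real n + 1))) = (real n + 1) ^ k * x ^ n" for n
  proof -
    have "exp (c * (real n + 1)) = exp (c * real n) * exp c"
      by (simp add: ring_distribs exp_add)
    then show ?thesis using c by (simp add: xn power_mult_distrib[of c] exp_minus divide_simps)
  qed
  ultimately show ?thesis by simp
qed

lemma word_map_Nil [simp]: "word_map f [] = id"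
  by (simp add: word_map_def)

lemma word_map_Cons [simp]: "word_map f (e # p) = f e \<circ> word_map f p"
  by (simp add: word_map_def)

lemma word_map_append: "word_map f (p @ p') = word_map f p \<circ> word_map f p'"
  by (induction p) (simp_all add: o_assoc)

lemma word_map_concat_replicate: "word_map f (concat (replicate k p)) = word_map f p ^^ k"
  by (induction k) (simp_all add: word_map_append)

lemma hausdorff_premeasure_le_sum_powr:
  fixes V :: "'i \<Rightarrow> 'a::real_normed_vector set"
  assumes "finite F" "A \<subseteq> (\<Union>i\<in>F. V i)"
    and V: "\<And>i x y. i \<in> F \<Longrightarrow> x \<in> V i \<Longrightarrow> y \<in> V i \<Longrightarrow> dist x y \<le> d i"
    and d: "\<And>i. i \<in> F \<Longrightarrow> 0 < d i" "\<And>i. i \<in> F \<Longrightarrow> d i \<le> \<eta>" and "0 \<le> \<eta>" "0 \<le> s"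
  shows "hausdorff_premeasure s \<eta> A \<le> ennreal (\<Sum>i\<in>F. d i powr s)"
proof -
  have bd: "bounded (V i)" if "i \<in> F" for i
  proof (cases "V i = {}")
    case False
    then obtain x where "x \<in> V i" by blast
    then show ?thesis unfolding bounded_def using V[OF that] by blast
  qed simp
  have diam: "diameter (V i) \<le> d i" if "i \<in> F" for i
    using V[OF that] d(1)[OF that] by (intro diameter_le) (auto simp: dist_norm)
  have "hausdorff_premeasure s \<eta> A \<le> (\<Sum>i\<in>F. diam_pow s (V i))"
    using bd diam d(2) assms(6) by (intro hausdorff_premeasure_le_sum assms(1,2)) (auto intro: order_trans)
  also have "\<dots> \<le> (\<Sum>i\<in>F. ennreal (d i powr s))"
    using bd diam d(1) assms(7) by (intro sum_mono diam_pow_le) auto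
  also have "\<dots> = ennreal (\<Sum>i\<in>F. d i powr s)" by (rule sum_ennreal) simp
  finally show ?thesis .
qed

locale gd_ifs_attractor = gd_ifs q G S r T v
  for q :: nat
    and G :: "(nat, 'e) pre_digraph"
    and S :: "'e \<Rightarrow> 'a \<Rightarrow> 'a::euclidean_space"
    and r :: "'e \<Rightarrow> real"
    and T :: "'e \<Rightarrow> 'a \<Rightarrow> 'a"
    and v :: "'e \<Rightarrow> 'a" +
  fixes K :: "nat \<Rightarrow> 'a set"
  assumes attractor: "is_attractor G S K"
begin

definition word_ratio :: "'e list \<Rightarrow> real" where
  "word_ratio p = prod_list (map r p)"

lemma word_ratio_append: "word_ratio (p @ p') = word_ratio p * word_ratio p'"
  by (simp add: word_ratio_def)

lemma word_ratio_pos: "set p \<subseteq> arcs G \<Longrightarrow> 0 < word_ratio p"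
  by (induction p) (auto simp: word_ratio_def ratio)

lemma word_ratio_le_power:
  assumes "\<And>e. e \<in> arcs G \<Longrightarrow> r e \<le> R" "set p \<subseteq> arcs G"
  shows "word_ratio p \<le> R ^ length p"
  using assms(2)
proof (induction p)
  case (Cons e p)
  then have "r e * word_ratio p \<le> R * R ^ length p"
    using assms(1)[of e] ratio[of e] word_ratio_pos[of p] by (intro mult_mono) auto
  then show ?case by (simp add: word_ratio_def)
qed (simp add: word_ratio_def)

lemma word_ratio_le_1:
  assumes "set p \<subseteq> arcs G"
  shows "word_ratio p \<le> 1"
  using word_ratio_le_power[of 1 p] assms ratio by (simp add: less_imp_le)

lemma ex_max_ratio: obtains R where "0 < R" "R < 1" "\<And>e. e \<in> arcs G \<Longrightarrow> r e \<le> R"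
proof -
  define R where "R = Max (insert (1/2) (r ` arcs G))"
  have R: "r e \<le> R" if "e \<in> arcs G" for e
    unfolding R_def using finite_arcs that by (intro Max_ge) auto
  have "1/2 \<le> R" unfolding R_def using finite_arcs by (intro Max_ge) auto
  moreover have "R < 1" unfolding R_def using finite_arcs ratio by (subst Max_less_iff) auto
  ultimately show thesis using R by (intro that[of R]) auto
qed

lemma orthogonal_word_map: "set p \<subseteq> arcs G \<Longrightarrow> orthogonal_transformation (word_map T p)"
proof (induction p)
  case (Cons e p)
  then show ?case
    using orthogonal[of e] by (simp only: word_map_Cons set_simps insert_subset orthogonal_transformation_compose)
qed (simp add: id_def)

lemma word_map_diff:
  assumes "set p \<subseteq> arcs G"
  shows "word_map S p x - word_map S p y = word_ratio p *\<^sub>R word_map T p (x - y)"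
  using assms
proof (induction p)
  case (Cons e p)
  then have e: "e \<in> arcs G" and p: "set p \<subseteq> arcs G" by auto
  have lin: "linear (T e)" using orthogonal[OF e] by (rule orthogonal_transformation_linear)
  have "word_map S (e # p) x - word_map S (e # p) y = r e *\<^sub>R T e (word_map S p x - word_map S p y)"
    by (simp add: similarity[OF e] linear_diff[OF lin] scaleR_diff_right)
  also have "\<dots> = word_ratio (e # p) *\<^sub>R word_map T (e # p) (x - y)"
    by (simp add: Cons.IH[OF p] linear_scale[OF lin] word_ratio_def)
  finally show ?case .
qed (simp add: word_ratio_def)

lemma dist_word_map:
  assumes "set p \<subseteq> arcs G"
  shows "dist (word_map S p x) (word_map S p y) = word_ratio p * dist x y"
  using word_ratio_pos[OF assms] orthogonal_transformation_norm[OF orthogonal_word_map[OF assms]]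
  by (simp add: dist_norm word_map_diff[OF assms])

lemma compact_K: "i \<in> verts G \<Longrightarrow> compact (K i)"
  and K_nonempty: "i \<in> verts G \<Longrightarrow> K i \<noteq> {}"
  and K_eq: "i \<in> verts G \<Longrightarrow> K i = (\<Union>k\<in>verts G. \<Union>e\<in>edges_between G i k. S e ` K k)"
  using attractor unfolding is_attractor_def by blast+

lemma word_map_image_subset:
  assumes "awalk i p k"
  shows "word_map S p ` K k \<subseteq> K i"
  using assms
proof (induction p arbitrary: i)
  case Nil
  then show ?case by (simp add: awalk_Nil_iff)
next
  case (Cons e p)
  then have e: "e \<in> arcs G" "i = tail G e" and p: "awalk (head G e) p k"
    by (simp_all add: awalk_Cons_iff)
  have verts: "i \<in> verts G" "head G e \<in> verts G" using e by auto
  have "e \<in> edges_between G i (head G e)" using e by (simp add: edges_between_def)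
  then have "S e ` K (head G e) \<subseteq> K i" using K_eq[OF verts(1)] verts(2) by blast
  then show ?case using Cons.IH[OF p] by (auto simp: image_subset_iff)
qed

lemma word_map_cover:
  assumes "i \<in> verts G" "x \<in> K i"
  shows "\<exists>p k. awalk i p k \<and> length p = n \<and> x \<in> word_map S p ` K k"
  using assms
proof (induction n arbitrary: i x)
  case 0
  then show ?case by (intro exI[of _ "[]"] exI[of _ i]) (simp add: awalk_Nil_iff)
next
  case (Suc n)
  obtain k e y where k: "k \<in> verts G" "e \<in> edges_between G i k" "y \<in> K k" "x = S e y"
    using K_eq[OF Suc.prems(1)] Suc.prems(2) by blast
  obtain p l where p: "awalk k p l" "length p = n" "y \<in> word_map S p ` K l"
    using Suc.IH[OF k(1,3)] by blast
  have "awalk i (e # p) l" using k(2) p(1) by (auto simp: awalk_Cons_iff edges_between_def)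
  moreover have "x \<in> word_map S (e # p) ` K l" using k(4) p(3) by auto
  ultimately show ?case using p(2) by (intro exI[of _ "e # p"] exI[of _ l]) simp
qed

lemma awalk_set: "awalk i p k \<Longrightarrow> set p \<subseteq> arcs G"
  by (simp add: awalk_def)

lemma K_diameter_bound:
  obtains D where "0 < D" "\<And>i x y. i \<in> verts G \<Longrightarrow> x \<in> K i \<Longrightarrow> y \<in> K i \<Longrightarrow> dist x y \<le> D"
proof -
  have bd: "bounded (\<Union>i\<in>verts G. K i)"
    using finite_verts compact_K compact_imp_bounded by (intro bounded_UN) auto
  \<comment> \<open>Adding 1 keeps \<open>D\<close> positive even if all the sets are
    points.\<close>
  define D where "D = diameter (\<Union>i\<in>verts G. K i) + 1"
  have "0 < D" unfolding D_def using diameter_ge_0[OF bd] by linarith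
  moreover have "dist x y \<le> D" if "i \<in> verts G" "x \<in> K i" "y \<in> K i" for i x y
    unfolding D_def using diameter_bounded_bound[OF bd, of x y] that by force
  ultimately show thesis by (rule that)
qed

text \<open>This makes the dimension of \<open>K j\<close> finite. At level n there are at most
  \<open>card (arcs G) ^ n * card (verts G)\<close> pieces of diameter at most
  \<open>D * R ^ n\<close>; an exponent \<open>k\<close> with
  \<open>card (arcs G) * R ^ k < 1\<close> beats their number.\<close>

lemma ex_zero_hausdorff_measure:
  assumes j: "j \<in> verts G"
  obtains s where "0 \<le> s" "hausdorff_measure s (K j) = 0"
proof -
  obtain R where R: "0 < R" "R < 1" "\<And>e. e \<in> arcs G \<Longrightarrow> r e \<le> R" using ex_max_ratio by blast
  obtain D where D: "0 < D" "\<And>i x y. i \<in> verts G \<Longrightarrow> x \<in> K i \<Longrightarrow> y \<in> K i \<Longrightarrow> dist x y \<le> D"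
    using K_diameter_bound by blast
  have "0 < 1 / (real (card (arcs G)) + 1)" by simp
  then obtain k where k: "R ^ k < 1 / (real (card (arcs G)) + 1)"
    using real_arch_pow_inv R(2) by blast
  define x where "x = real (card (arcs G)) * R ^ k"
  have "(real (card (arcs G)) + 1) * R ^ k < 1" using k by (simp add: field_simps)
  then have x: "0 \<le> x" "x < 1"
    using zero_less_power[OF R(1), of k] unfolding x_def distrib_right by simp_all
  define b where "b n = real (card (verts G)) * D ^ k * x ^ n" for n
  have b_lim: "b \<longlonglongrightarrow> 0"
    unfolding b_def using x by (intro tendsto_mult_right_zero LIMSEQ_realpow_zero) auto
  have "hausdorff_premeasure (real k) \<eta> (K j) = 0" if \<eta>: "0 < \<eta>" for \<eta>
  proof -
    have "(\<lambda>n. D * R ^ n) \<longlonglongrightarrow> 0"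
      using R by (intro tendsto_mult_right_zero LIMSEQ_realpow_zero) auto
    then have "\<forall>\<^sub>F n in sequentially. D * R ^ n < \<eta>" using \<eta> by (rule order_tendstoD(2))
    then have "\<forall>\<^sub>F n in sequentially. hausdorff_premeasure (real k) \<eta> (K j) \<le> ennreal (b n)"
    proof eventually_elim
      case (elim n)
      define F where "F = {p. set p \<subseteq> arcs G \<and> length p = n} \<times> verts G"
      have finF: "finite F" unfolding F_def
        by (intro finite_cartesian_product finite_lists_length_eq finite_arcs finite_verts)
      have cardF: "card F = card (arcs G) ^ n * card (verts G)"
        unfolding F_def by (simp add: card_cartesian_product card_lists_length_eq)
      have "hausdorff_premeasure (real k) \<eta> (K j) \<le> ennreal (\<Sum>i\<in>F. (D * R ^ n) powr real k)"
      proof (rule hausdorff_premeasure_le_sum_powr[OF finF, of _ "\<lambda>(p, i). word_map S p ` K i"])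
        show "K j \<subseteq> (\<Union>i\<in>F. case i of (p, i) \<Rightarrow> word_map S p ` K i)"
        proof
          fix x assume "x \<in> K j"
          then obtain p i where p: "awalk j p i" "length p = n" "x \<in> word_map S p ` K i"
            using word_map_cover[OF j] by blast
          then have "(p, i) \<in> F" unfolding F_def using awalk_last_in_verts awalk_set by auto
          then show "x \<in> (\<Union>i\<in>F. case i of (p, i) \<Rightarrow> word_map S p ` K i)" using p(3) by blast
        qed
      next
        fix a x y assume a: "a \<in> F" and x: "x \<in> (case a of (p, i) \<Rightarrow> word_map S p ` K i)"
          and y: "y \<in> (case a of (p, i) \<Rightarrow> word_map S p ` K i)"
        obtain p i where p: "a = (p, i)" by (cases a)
        obtain x' y' where xy: "x = word_map S p x'" "y = word_map S p y'" "x' \<in> K i" "y' \<in> K i"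
          using x y unfolding p by auto
        have set_p: "set p \<subseteq> arcs G" and len: "length p = n" and i: "i \<in> verts G"
          using a unfolding p F_def by auto
        have "dist x y = word_ratio p * dist x' y'" unfolding xy by (rule dist_word_map[OF set_p])
        also have "\<dots> \<le> R ^ n * D"
          using word_ratio_le_power[OF R(3) set_p] D(2)[OF i xy(3,4)] R(1) D(1) len by (intro mult_mono) auto
        finally show "dist x y \<le> D * R ^ n" by (simp add: mult.commute)
      qed (use elim D R \<eta> in auto)
      also have "(\<Sum>i\<in>F. (D * R ^ n) powr real k) = b n"
      proof -
        have "(D * R ^ n) powr real k = D ^ k * (R ^ k) ^ n"
          using D(1) R(1) by (simp add: powr_realpow power_mult_distrib power_mult[symmetric] mult.commute)
        then show ?thesis by (simp add: cardF b_def x_def power_mult_distrib)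
      qed
      finally show ?case .
    qed
    then have "hausdorff_premeasure (real k) \<eta> (K j) \<le> ennreal 0"
      by (intro tendsto_lowerbound[OF tendsto_ennrealI[OF b_lim]]) auto
    then show ?thesis by simp
  qed
  then have "hausdorff_measure (real k) (K j) \<le> 0"
    unfolding hausdorff_measure_def by (intro SUP_least) simp
  then have "hausdorff_measure (real k) (K j) = 0" by simp
  then show thesis by (intro that[of "real k"]) auto
qed

section \<open>Homogeneous subsystems of almost full dimension\<close>

text \<open>Walks cannot be reversed, so the inverse rotation must come from another cycle. Two
  powers of the rotation coincide in a finite group, hence \<open>?g ^^ Suc d = id\<close> for some
  \<open>d\<close>, and repeating \<open>p\<close> another \<open>d\<close> times undoes
  \<open>p\<close>. The walk is empty when \<open>d = 0\<close>.\<close>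

lemma directed_cycle_inverse:
  assumes fin: "finite (transformation_group G T j)" and p: "p \<in> directed_cycles G j"
  obtains z where "awalk j z j" "word_map T p \<circ> word_map T z = id"
proof -
  have walk: "awalk j p j" and ne: "p \<noteq> []" using p by (auto simp: directed_cycles_def)
  let ?g = "word_map T p"
  have rep: "awalk j (concat (replicate k p)) j" for k
  proof (induction k)
    case 0
    then show ?case using awalk_hd_in_verts[OF walk] by (simp add: awalk_Nil_iff)
  next
    case (Suc k)
    then show ?case using awalk_appendI[OF walk] by simp
  qed
  have "?g ^^ Suc k \<in> transformation_group G T j" for k
  proof -
    have "concat (replicate (Suc k) p) \<in> directed_cycles G j"
      using rep[of "Suc k"] ne by (auto simp: directed_cycles_def Suc_le_eq)
    then have "word_map T (concat (replicate (Suc k) p)) \<in> transformation_group G T j"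
      unfolding transformation_group_def by (intro generate.incl imageI)
    then show ?thesis by (simp only: word_map_concat_replicate)
  qed
  then have "finite (range (\<lambda>k. ?g ^^ Suc k))" using fin by (elim finite_subset[rotated]) auto
  then have "\<not> inj (\<lambda>k. ?g ^^ Suc k)" using finite_imageD infinite_UNIV_nat by blast
  then obtain k l where "k \<noteq> l" "?g ^^ Suc k = ?g ^^ Suc l" unfolding inj_def by blast
  then obtain k l where kl: "k < l" "?g ^^ Suc k = ?g ^^ Suc l"
    by (metis linorder_neqE_nat)
  have inj: "inj ?g" by (intro orthogonal_transformation_inj orthogonal_word_map awalk_set[OF walk])
  define d where "d = l - Suc k"
  have "Suc l = Suc k + Suc d" using kl(1) by (simp add: d_def)
  then have "?g ^^ Suc l = ?g ^^ Suc k \<circ> ?g ^^ Suc d" by (simp only: funpow_add)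
  then have eq: "(?g ^^ Suc k) ((?g ^^ Suc d) x) = (?g ^^ Suc k) x" for x
    by (metis kl(2) o_apply)
  have "?g ^^ Suc d = id"
    using inj_fn[OF inj, of "Suc k"] eq unfolding inj_def by (metis ext id_apply)
  then have "?g \<circ> word_map T (concat (replicate d p)) = id"
    by (simp only: word_map_concat_replicate funpow.simps)
  then show thesis using rep by (intro that)
qed

text \<open>
  For fixed length there are only polynomially many nonempty classes, and the ratio of a word
  depends on its class only.
\<close>

definition walk_class ::
  "(nat \<Rightarrow> 'e list) \<Rightarrow> nat \<Rightarrow> nat \<Rightarrow> ('e \<Rightarrow> nat) \<times> nat \<times> ('a \<Rightarrow> 'a) \<Rightarrow> 'e list set" where
  "walk_class u j n = (\<lambda>(c, i, g). {p. awalk j p i \<and> length p = n \<and>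
     restrict (count_list p) (arcs G) = c \<and> word_map T (p @ u i) = g})"

text \<open>A Vitali argument in each class: all pieces of a class have diameter at most
  \<open>\<beta> * D\<close>, so those meeting a chosen piece fit into a set of diameter at most
  \<open>3 * D * \<beta>\<close>, and the enlarged chosen pieces of all classes cover
  \<open>K j\<close>. By pigeonhole some class carries its share of the premeasure bound.\<close>

lemma rich_disjoint_class:
  assumes j: "j \<in> verts G" and fin: "finite (transformation_group G T j)"
    and u: "\<And>i. i \<in> verts G \<Longrightarrow> awalk i (u i) j"
    and D: "0 < D" "\<And>i x y. i \<in> verts G \<Longrightarrow> x \<in> K i \<Longrightarrow> y \<in> K i \<Longrightarrow> dist x y \<le> D"
    and n: "0 < n" and \<eta>: "\<And>p. set p \<subseteq> arcs G \<Longrightarrow> length p = n \<Longrightarrow> 3 * D * word_ratio p \<le> \<eta>" "0 \<le> \<eta>"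
    and s: "0 \<le> s" and c: "0 < c" "ennreal c \<le> hausdorff_premeasure s \<eta> (K j)"
  obtains F i g \<beta> where "finite F" "i \<in> verts G" "g \<in> word_map T ` directed_cycles G j" "0 < \<beta>"
    "\<forall>p\<in>F. awalk j p i \<and> length p = n \<and> word_ratio p = \<beta> \<and> word_map T (p @ u i) = g"
    "disjoint_family_on (\<lambda>p. word_map S p ` K i) F"
    "c \<le> (real n + 1) ^ card (arcs G) * real (card (verts G)) *
      real (card (word_map T ` directed_cycles G j)) * (real (card F) * (3 * D * \<beta>) powr s)"
proof -
  let ?TG = "word_map T ` directed_cycles G j"
  \<comment> \<open>Classes record the rotation of \<open>p @ u i\<close> rather than of
    \<open>p\<close>: only the former is a cycle at \<open>j\<close>, and its rotation lies in a
    finite set.\<close>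
  define Q where "Q = (PiE (arcs G) (\<lambda>_. {..n})) \<times> verts G \<times> ?TG"
  define M where "M = (real n + 1) ^ card (arcs G) * real (card (verts G)) * real (card ?TG)"
  have "?TG \<subseteq> transformation_group G T j"
    unfolding transformation_group_def by (auto intro: generate.incl)
  then have finTG: "finite ?TG" using fin by (rule finite_subset)
  have finQ: "finite Q" unfolding Q_def
    by (intro finite_cartesian_product finite_PiE finite_arcs finite_verts finTG finite_atMost)
  have cardQ: "real (card Q) = M"
    unfolding Q_def M_def by (simp add: card_cartesian_product card_PiE finite_arcs add.commute)
  have fin_class: "finite (walk_class u j n a)" for a
  proof -
    have "walk_class u j n a \<subseteq> {p. set p \<subseteq> arcs G \<and> length p = n}"
      unfolding walk_class_def using awalk_set by (auto split: prod.splits)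
    then show ?thesis using finite_lists_length_eq[OF finite_arcs] by (rule finite_subset)
  qed
  define V where "V a p = word_map S p ` K (fst (snd a))" for a :: "('e \<Rightarrow> nat) \<times> nat \<times> ('a \<Rightarrow> 'a)" and p
  have "\<forall>a. \<exists>F. F \<subseteq> walk_class u j n a \<and> (\<forall>p\<in>F. \<forall>p'\<in>F. p \<noteq> p' \<longrightarrow> V a p \<inter> V a p' = {}) \<and>
      (\<forall>p\<in>walk_class u j n a. V a p \<noteq> {} \<longrightarrow> (\<exists>p'\<in>F. V a p \<inter> V a p' \<noteq> {}))"
  proof
    fix a
    show "\<exists>F. F \<subseteq> walk_class u j n a \<and> (\<forall>p\<in>F. \<forall>p'\<in>F. p \<noteq> p' \<longrightarrow> V a p \<inter> V a p' = {}) \<and>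
      (\<forall>p\<in>walk_class u j n a. V a p \<noteq> {} \<longrightarrow> (\<exists>p'\<in>F. V a p \<inter> V a p' \<noteq> {}))"
      by (rule maximal_disjoint_subfamily[OF fin_class[of a], of "V a"])
         (intro exI conjI ballI impI; assumption?; simp)
  qed
  then have "\<exists>F. \<forall>a. F a \<subseteq> walk_class u j n a \<and> (\<forall>p\<in>F a. \<forall>p'\<in>F a. p \<noteq> p' \<longrightarrow> V a p \<inter> V a p' = {}) \<and>
      (\<forall>p\<in>walk_class u j n a. V a p \<noteq> {} \<longrightarrow> (\<exists>p'\<in>F a. V a p \<inter> V a p' \<noteq> {}))"
    by (rule choice)
  then obtain F where *: "\<forall>a. F a \<subseteq> walk_class u j n a \<and> (\<forall>p\<in>F a. \<forall>p'\<in>F a. p \<noteq> p' \<longrightarrow> V a p \<inter> V a p' = {}) \<and>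
      (\<forall>p\<in>walk_class u j n a. V a p \<noteq> {} \<longrightarrow> (\<exists>p'\<in>F a. V a p \<inter> V a p' \<noteq> {}))" ..
  note F = *[THEN spec, THEN conjunct1] *[THEN spec, THEN conjunct2, THEN conjunct1]
    *[THEN spec, THEN conjunct2, THEN conjunct2]
  have finF: "finite (F a)" for a using F(1) fin_class by (rule finite_subset)
  define \<beta> where "\<beta> a = (\<Prod>e\<in>arcs G. r e ^ fst a e)" for a :: "('e \<Rightarrow> nat) \<times> nat \<times> ('a \<Rightarrow> 'a)"
  have class_set: "set p \<subseteq> arcs G" "length p = n" "word_ratio p = \<beta> a" "awalk j p (fst (snd a))"
    if "p \<in> walk_class u j n a" for p a
  proof -
    from that have w: "awalk j p (fst (snd a))" "length p = n" "restrict (count_list p) (arcs G) = fst a"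
      unfolding walk_class_def by (auto split: prod.splits)
    show p: "set p \<subseteq> arcs G" by (rule awalk_set[OF w(1)])
    show "length p = n" "awalk j p (fst (snd a))" by fact+
    have "word_ratio p = (\<Prod>e\<in>arcs G. r e ^ count_list p e)"
      unfolding word_ratio_def by (rule prod_list_eq_prod_count_list[OF finite_arcs p])
    also have "\<dots> = \<beta> a" unfolding \<beta>_def w(3)[symmetric] by (intro prod.cong) auto
    finally show "word_ratio p = \<beta> a" .
  qed
  have \<beta>_pos: "0 < \<beta> a" for a unfolding \<beta>_def using ratio by (intro prod_pos) auto
  have V_dist: "dist x y \<le> \<beta> a * D"
    if p: "p \<in> walk_class u j n a" and i: "fst (snd a) \<in> verts G" and V: "x \<in> V a p" "y \<in> V a p" for a p x y
  proof -
    obtain x' y' where xy: "x = word_map S p x'" "y = word_map S p y'"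
      "x' \<in> K (fst (snd a))" "y' \<in> K (fst (snd a))"
      using V unfolding V_def by blast
    have "dist x y = \<beta> a * dist x' y'"
      unfolding xy dist_word_map[OF class_set(1)[OF p]] class_set(3)[OF p] ..
    also have "\<dots> \<le> \<beta> a * D" using D(2)[OF i xy(3,4)] \<beta>_pos[of a] by (intro mult_left_mono) auto
    finally show ?thesis .
  qed
  \<comment> \<open>The enlarged piece around \<open>p'\<close>: all pieces of its class that meet
    it.\<close>
  define W where "W = (\<lambda>(a, p'). \<Union>p\<in>{p \<in> walk_class u j n a. V a p \<inter> V a p' \<noteq> {}}. V a p)"
  define I where "I = (SIGMA a:Q. F a)"
  have "ennreal c \<le> ennreal (\<Sum>b\<in>I. (3 * D * \<beta> (fst b)) powr s)"
  proof (rule order_trans[OF c(2)], rule hausdorff_premeasure_le_sum_powr[where V = W])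
    show "finite I" unfolding I_def using finQ finF by (intro finite_SigmaI) auto
    show "K j \<subseteq> \<Union> (W ` I)"
    proof
      fix x assume "x \<in> K j"
      then obtain p i where p: "awalk j p i" "length p = n" "x \<in> word_map S p ` K i"
        using word_map_cover[OF j] by blast
      define a where "a = (restrict (count_list p) (arcs G), i, word_map T (p @ u i))"
      have i: "i \<in> verts G" using awalk_last_in_verts[OF p(1)] .
      have "p @ u i \<in> directed_cycles G j"
        using awalk_appendI[OF p(1) u[OF i]] p(2) n by (auto simp: directed_cycles_def)
      moreover have "restrict (count_list p) (arcs G) \<in> PiE (arcs G) (\<lambda>_. {..n})"
        using p(2) count_le_length by auto
      ultimately have aQ: "a \<in> Q" using i by (simp add: a_def Q_def)
      have pa: "p \<in> walk_class u j n a" using p by (simp add: walk_class_def a_def)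
      have xV: "x \<in> V a p" using p(3) by (simp add: V_def a_def)
      then have "V a p \<noteq> {}" by blast
      then obtain p' where p': "p' \<in> F a" "V a p \<inter> V a p' \<noteq> {}" using F(3) pa by blast
      have "(a, p') \<in> I" using aQ p'(1) by (simp add: I_def)
      moreover have "x \<in> W (a, p')" unfolding W_def using pa p'(2) xV by auto
      ultimately show "x \<in> \<Union> (W ` I)" by blast
    qed
  next
    fix b x y assume b: "b \<in> I" and x: "x \<in> W b" and y: "y \<in> W b"
    obtain a p' where ap: "b = (a, p')" by (cases b)
    have a: "fst (snd a) \<in> verts G" and p': "p' \<in> walk_class u j n a"
      using b subsetD[OF F(1)[of a]] unfolding I_def Q_def ap by auto
    obtain p1 where p1: "p1 \<in> walk_class u j n a" "V a p1 \<inter> V a p' \<noteq> {}" "x \<in> V a p1"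
      using x unfolding W_def ap by auto
    obtain p2 where p2: "p2 \<in> walk_class u j n a" "V a p2 \<inter> V a p' \<noteq> {}" "y \<in> V a p2"
      using y unfolding W_def ap by auto
    obtain x1 where x1: "x1 \<in> V a p1" "x1 \<in> V a p'" using p1(2) by blast
    obtain x2 where x2: "x2 \<in> V a p2" "x2 \<in> V a p'" using p2(2) by blast
    have "dist x y \<le> dist x x1 + dist x1 x2 + dist x2 y"
      using dist_triangle[of x y x1] dist_triangle[of x1 y x2] by linarith
    also have "\<dots> \<le> \<beta> a * D + \<beta> a * D + \<beta> a * D"
      using V_dist[OF p1(1) a p1(3) x1(1)] V_dist[OF p' a x1(2) x2(2)] V_dist[OF p2(1) a x2(1) p2(3)]
      by linarith
    finally show "dist x y \<le> 3 * D * \<beta> (fst b)" by (simp add: ap)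
  next
    fix b assume b: "b \<in> I"
    show "0 < 3 * D * \<beta> (fst b)" using D(1) \<beta>_pos by simp
    have "snd b \<in> walk_class u j n (fst b)" using b subsetD[OF F(1)[of "fst b"]] unfolding I_def by auto
    then show "3 * D * \<beta> (fst b) \<le> \<eta>" using class_set \<eta>(1) by metis
  qed (use \<eta> s in auto)
  then have "c \<le> (\<Sum>b\<in>I. (3 * D * \<beta> (fst b)) powr s)"
    by (subst (asm) ennreal_le_iff) (auto intro: sum_nonneg)
  also have "\<dots> = (\<Sum>a\<in>Q. \<Sum>p\<in>F a. (3 * D * \<beta> a) powr s)"
    unfolding I_def using finQ finF by (subst sum.Sigma) (auto simp: case_prod_beta)
  also have "\<dots> = (\<Sum>a\<in>Q. real (card (F a)) * (3 * D * \<beta> a) powr s)" by simp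
  finally have c_le: "c \<le> (\<Sum>a\<in>Q. real (card (F a)) * (3 * D * \<beta> a) powr s)" .
  have "\<exists>a\<in>Q. c \<le> M * (real (card (F a)) * (3 * D * \<beta> a) powr s)"
  proof (rule ccontr)
    assume "\<not> ?thesis"
    then have *: "\<And>a. a \<in> Q \<Longrightarrow> M * (real (card (F a)) * (3 * D * \<beta> a) powr s) < c" by force
    have "Q \<noteq> {}" using c_le c(1) by auto
    then have M: "0 < M" using finQ cardQ by (metis card_gt_0_iff of_nat_0_less_iff)
    have "(\<Sum>a\<in>Q. M * (real (card (F a)) * (3 * D * \<beta> a) powr s)) < (\<Sum>a\<in>Q. c)"
      using * finQ \<open>Q \<noteq> {}\<close> by (intro sum_strict_mono) auto
    then have "M * (\<Sum>a\<in>Q. real (card (F a)) * (3 * D * \<beta> a) powr s) < M * c"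
      using cardQ by (simp add: sum_distrib_left)
    then show False using c_le M by simp
  qed
  then obtain a where a: "a \<in> Q" "c \<le> M * (real (card (F a)) * (3 * D * \<beta> a) powr s)" by blast
  show thesis
  proof (rule that[of "F a" "fst (snd a)" "snd (snd a)" "\<beta> a"])
    show "finite (F a)" by (rule finF)
    show "fst (snd a) \<in> verts G" "snd (snd a) \<in> ?TG" using a(1) unfolding Q_def by auto
    show "0 < \<beta> a" by (rule \<beta>_pos)
    show "c \<le> (real n + 1) ^ card (arcs G) * real (card (verts G)) *
        real (card ?TG) * (real (card (F a)) * (3 * D * \<beta> a) powr s)"
      using a(2) unfolding M_def .
    show "\<forall>p\<in>F a. awalk j p (fst (snd a)) \<and> length p = n \<and> word_ratio p = \<beta> a \<and>
        word_map T (p @ u (fst (snd a))) = snd (snd a)"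
    proof
      fix p assume "p \<in> F a"
      then have p: "p \<in> walk_class u j n a" using F(1) by blast
      then show "awalk j p (fst (snd a)) \<and> length p = n \<and> word_ratio p = \<beta> a \<and>
          word_map T (p @ u (fst (snd a))) = snd (snd a)"
        using class_set[OF p] unfolding walk_class_def by (auto split: prod.splits)
    qed
    show "disjoint_family_on (\<lambda>p. word_map S p ` K (fst (snd a))) (F a)"
      using F(2)[of a] unfolding V_def disjoint_family_on_def by blast
  qed
qed

lemma word_map_eq:
  assumes "set p \<subseteq> arcs G"
  shows "word_map S p x = word_ratio p *\<^sub>R word_map T p x + word_map S p 0"
  using word_map_diff[OF assms, of x 0] by (simp add: algebra_simps)

text \<open>Each word of a rich class is continued by \<open>u i\<close> back to \<open>j\<close>
  and by \<open>z g\<close>, which cancels the common rotation \<open>g\<close>. The resulting maps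
  share one ratio and have no rotation. The gap between t and s absorbs the polynomial number of
  classes and the bounded cost of the continuation.\<close>

lemma homogeneous_subsystem:
  fixes L :: "'a \<Rightarrow> 'b::euclidean_space"
  assumes connected: "strongly_connected G" and j: "j \<in> verts G"
    and fin: "finite (transformation_group G T j)" and L: "linear L"
    and t: "0 \<le> t" "ereal t < hausdorff_dim (K j)"
  obtains \<rho> N w where "homogeneous_ifs \<rho> N w (K j) L" "1 \<le> real N * \<rho> powr t"
proof -
  let ?TG = "word_map T ` directed_cycles G j"
  obtain s where s: "t < s" "ereal s < hausdorff_dim (K j)"
    using ereal_dense2[OF t(2)] by auto
  have "hausdorff_measure s (K j) \<noteq> 0"
    using hausdorff_dim_le[of s "K j"] s t by (auto simp: not_le[symmetric])
  then obtain \<eta> where \<eta>: "0 < \<eta>" "hausdorff_premeasure s \<eta> (K j) \<noteq> 0"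
    unfolding hausdorff_measure_def
    by (metis (no_types, lifting) SUP_least greaterThan_iff le_zero_eq order_refl)
  have "\<exists>c>0. ennreal c \<le> hausdorff_premeasure s \<eta> (K j)"
  proof (cases "hausdorff_premeasure s \<eta> (K j)")
    case (real c)
    then show ?thesis using \<eta>(2) by (intro exI[of _ c]) auto
  next
    case top
    then show ?thesis by (intro exI[of _ 1]) auto
  qed
  then obtain c where c: "0 < c" "ennreal c \<le> hausdorff_premeasure s \<eta> (K j)" by blast
  have "\<forall>i\<in>verts G. \<exists>p. awalk i p j"
    using connected j reachable_awalk unfolding strongly_connected_def by blast
  then obtain u where u: "\<And>i. i \<in> verts G \<Longrightarrow> awalk i (u i) j" by metis
  have "\<forall>g\<in>?TG. \<exists>z. awalk j z j \<and> g \<circ> word_map T z = id"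
  proof
    fix g assume "g \<in> ?TG"
    then obtain p where "p \<in> directed_cycles G j" "g = word_map T p" by blast
    then show "\<exists>z. awalk j z j \<and> g \<circ> word_map T z = id"
      using directed_cycle_inverse[OF fin, of p] by metis
  qed
  then obtain z where z: "\<And>g. g \<in> ?TG \<Longrightarrow> awalk j (z g) j" "\<And>g. g \<in> ?TG \<Longrightarrow> g \<circ> word_map T (z g) = id"
    by metis
  have "?TG \<subseteq> transformation_group G T j"
    unfolding transformation_group_def by (auto intro: generate.incl)
  then have finTG: "finite ?TG" using fin by (rule finite_subset)
  \<comment> \<open>A lower bound for the ratio of every continuation \<open>u i @ z g\<close>; it
    is independent of the word length n, which is chosen later.\<close>
  define \<kappa> where "\<kappa> = Min (insert 1 ((\<lambda>(i, g). word_ratio (u i) * word_ratio (z g)) ` (verts G \<times> ?TG)))"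
  have fin\<kappa>: "finite (insert 1 ((\<lambda>(i, g). word_ratio (u i) * word_ratio (z g)) ` (verts G \<times> ?TG)))"
    using finTG finite_verts by blast
  have \<kappa>_le: "\<kappa> \<le> word_ratio (u i) * word_ratio (z g)" if "i \<in> verts G" "g \<in> ?TG" for i g
    unfolding \<kappa>_def using that by (intro Min_le fin\<kappa>) force
  have uz_pos: "0 < word_ratio (u i) * word_ratio (z g)" if "i \<in> verts G" "g \<in> ?TG" for i g
    using that u z(1) awalk_set by (intro mult_pos_pos word_ratio_pos) blast+
  then have \<kappa>: "0 < \<kappa>" unfolding \<kappa>_def by (subst Min_gr_iff[OF fin\<kappa>]) auto
  obtain R where R: "0 < R" "R < 1" "\<And>e. e \<in> arcs G \<Longrightarrow> r e \<le> R" using ex_max_ratio by blast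
  obtain D where D: "0 < D" "\<And>i x y. i \<in> verts G \<Longrightarrow> x \<in> K i \<Longrightarrow> y \<in> K i \<Longrightarrow> dist x y \<le> D"
    using K_diameter_bound by blast
  define M where "M n = (real n + 1) ^ card (arcs G) * real (card (verts G)) * real (card ?TG)" for n
  \<comment> \<open>Chosen so that \<open>M n * \<beta> powr (s - t) < C\<close>, together with the
    lower bound for the rich class, yields
    \<open>1 < card F * (\<kappa> * \<beta>) powr t\<close>.\<close>
  define C where "C = c * \<kappa> powr t / (3 * D) powr s"
  have C: "0 < C" using c(1) \<kappa> D(1) by (simp add: C_def)
  have "R powr (s - t) < 1" using powr_less_mono2[of "s - t" R 1] R s by simp
  then have "(\<lambda>n. (real n + 1) ^ card (arcs G) * (R powr (s - t)) ^ n) \<longlonglongrightarrow> 0"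
    using R by (intro power_mult_exp_tendsto_0) auto
  then have "(\<lambda>n. (real n + 1) ^ card (arcs G) * (R powr (s - t)) ^ n *
      (real (card (verts G)) * real (card ?TG))) \<longlonglongrightarrow> 0"
    by (rule tendsto_mult_left_zero)
  then have "\<forall>\<^sub>F n in sequentially. (real n + 1) ^ card (arcs G) * (R powr (s - t)) ^ n *
      (real (card (verts G)) * real (card ?TG)) < C"
    using C by (rule order_tendstoD(2))
  moreover have "(\<lambda>n. 3 * D * R ^ n) \<longlonglongrightarrow> 0"
    using R by (intro tendsto_mult_right_zero LIMSEQ_realpow_zero) auto
  then have "\<forall>\<^sub>F n in sequentially. 3 * D * R ^ n < \<eta>" using \<eta>(1) by (rule order_tendstoD(2))
  moreover have "\<forall>\<^sub>F n in sequentially. 0 < n" by (rule eventually_gt_at_top)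
  ultimately have "\<forall>\<^sub>F n in sequentially. M n * (R powr (s - t)) ^ n < C \<and> 3 * D * R ^ n < \<eta> \<and> 0 < n"
    by eventually_elim (simp add: M_def mult_ac)
  then obtain n where n: "M n * (R powr (s - t)) ^ n < C" "3 * D * R ^ n < \<eta>" "0 < n"
    using eventually_happens by force
  have small: "3 * D * word_ratio p \<le> \<eta>" if "set p \<subseteq> arcs G" "length p = n" for p
  proof -
    have "3 * D * word_ratio p \<le> 3 * D * R ^ n"
      using word_ratio_le_power[OF R(3) that(1)] that(2) D(1) by (intro mult_left_mono) auto
    then show ?thesis using n(2) by linarith
  qed
  have nonneg: "0 \<le> \<eta>" "0 \<le> s" using \<eta>(1) s t by auto
  obtain F i g \<beta> where F: "finite F" and i: "i \<in> verts G" and g: "g \<in> ?TG" and \<beta>: "0 < \<beta>"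
    and cls: "\<forall>p\<in>F. awalk j p i \<and> length p = n \<and> word_ratio p = \<beta> \<and> word_map T (p @ u i) = g"
    and dis: "disjoint_family_on (\<lambda>p. word_map S p ` K i) F"
    and cM: "c \<le> M n * (real (card F) * (3 * D * \<beta>) powr s)"
    by (rule rich_disjoint_class[OF j fin, of u D n \<eta> s c, folded M_def])
       (rule u D n(3) small nonneg c that; assumption)+
  define \<rho> where "\<rho> = \<beta> * (word_ratio (u i) * word_ratio (z g))"
  obtain h where h: "bij_betw h {..<card F} F"
    using ex_bij_betw_nat_finite[OF F] by (auto simp: atLeast0LessThan)
  define m where "m l = h l @ u i @ z g" for l
  \<comment> \<open>The translation part of a rotation-free map is the image of 0; beyond the family
    it is set to 0 as \<open>homogeneous_ifs\<close> requires.\<close>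
  define w where "w l = (if l < card F then word_map S (m l) 0 else 0)" for l
  have hF: "h l \<in> F" if "l < card F" for l using h that unfolding bij_betw_def by blast
  have F_ne: "F \<noteq> {}" using cM c(1) by auto
  then obtain p0 where p0: "p0 \<in> F" by blast
  have \<beta>_le: "\<beta> \<le> R ^ n"
    using word_ratio_le_power[OF R(3) awalk_set[of j p0 i]] bspec[OF cls p0] by simp
  have m_walk: "awalk j (m l) j" if "l < card F" for l
    unfolding m_def using bspec[OF cls hF[OF that]] u[OF i] z(1)[OF g] by (intro awalk_appendI) auto
  have m_eq: "word_map S (m l) x = \<rho> *\<^sub>R x + w l" if l: "l < card F" for l x
  proof -
    have "word_map T (m l) = g \<circ> word_map T (z g)"
      using bspec[OF cls hF[OF l]] by (simp add: m_def word_map_append o_assoc)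
    then have "word_map T (m l) = id" using z(2)[OF g] by simp
    moreover have "word_ratio (m l) = \<rho>"
      using bspec[OF cls hF[OF l]] by (simp add: m_def word_ratio_append \<rho>_def)
    ultimately show ?thesis
      using word_map_eq[OF awalk_set[OF m_walk[OF l]], of x] l by (simp add: w_def)
  qed
  \<comment> \<open>The continued images stay inside the pieces of the disjoint family and inherit
    its disjointness.\<close>
  have m_sub: "word_map S (m l) ` K j \<subseteq> word_map S (h l) ` K i" if "l < card F" for l
  proof -
    have "awalk i (u i @ z g) j" using u[OF i] z(1)[OF g] by (intro awalk_appendI)
    then have "word_map S (u i @ z g) ` K j \<subseteq> K i" by (rule word_map_image_subset)
    then have "word_map S (h l) ` word_map S (u i @ z g) ` K j \<subseteq> word_map S (h l) ` K i"
      by (rule image_mono)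
    then show ?thesis by (simp only: m_def word_map_append image_comp o_assoc)
  qed
  have \<rho>0: "0 < \<rho>" using \<beta> uz_pos[OF i g] by (simp add: \<rho>_def)
  have "word_ratio (u i) * word_ratio (z g) \<le> 1 * 1"
    using awalk_set[OF u[OF i]] awalk_set[OF z(1)[OF g]]
    by (intro mult_mono word_ratio_le_1 word_ratio_pos[THEN less_imp_le]) simp_all
  then have "\<rho> \<le> \<beta> * 1" unfolding \<rho>_def using \<beta> by (intro mult_left_mono) auto
  also have "\<beta> * 1 < 1" using \<beta>_le power_Suc_less_one[of R "n - 1"] R n(3) by simp
  finally have \<rho>1: "\<rho> < 1" .
  have "homogeneous_ifs \<rho> (card F) w (K j) L"
  proof (rule homogeneous_ifs.intro)
    show "0 < \<rho>" "\<rho> < 1" by (rule \<rho>0 \<rho>1)+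
    show "0 < card F" using F F_ne by (simp add: card_gt_0_iff)
    show "compact (K j)" "K j \<noteq> {}" by (rule compact_K[OF j] K_nonempty[OF j])+
    show "linear L" by fact
  next
    fix l assume "card F \<le> l" then show "w l = 0" by (simp add: w_def)
  next
    fix l x assume l: "l < card F" and x: "x \<in> K j"
    have "word_map S (m l) x \<in> K j" using word_map_image_subset[OF m_walk[OF l]] x by blast
    then show "\<rho> *\<^sub>R x + w l \<in> K j" by (simp add: m_eq[OF l])
  next
    fix l k x y assume *: "l < card F" "k < card F" "l \<noteq> k" "x \<in> K j" "y \<in> K j"
    have "h l \<noteq> h k" using h * unfolding bij_betw_def inj_on_def by auto
    then have "word_map S (h l) ` K i \<inter> word_map S (h k) ` K i = {}"
      using dis hF[OF *(1)] hF[OF *(2)] unfolding disjoint_family_on_def by blast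
    moreover have "\<rho> *\<^sub>R x + w l \<in> word_map S (h l) ` K i"
      using m_sub[OF *(1)] *(4) unfolding m_eq[OF *(1), symmetric] by blast
    moreover have "\<rho> *\<^sub>R y + w k \<in> word_map S (h k) ` K i"
      using m_sub[OF *(2)] *(5) unfolding m_eq[OF *(2), symmetric] by blast
    ultimately show "\<rho> *\<^sub>R x + w l \<noteq> \<rho> *\<^sub>R y + w k" by (metis disjoint_iff)
  qed
  moreover have "1 \<le> real (card F) * \<rho> powr t"
  proof -
    define x where "x = real (card F)"
    have x: "0 < x" using F F_ne by (simp add: x_def card_gt_0_iff)
    have M0: "0 < M n"
    proof (rule ccontr)
      assume "\<not> 0 < M n"
      then have "M n * (real (card F) * (3 * D * \<beta>) powr s) \<le> 0" by (intro mult_nonpos_nonneg) auto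
      then show False using cM c(1) by linarith
    qed
    have "\<beta> powr (s - t) \<le> (R ^ n) powr (s - t)" using \<beta> \<beta>_le s by (intro powr_mono2) auto
    also have "\<dots> = (R powr (s - t)) ^ n"
      using R by (simp add: powr_powr powr_realpow[symmetric] mult.commute)
    finally have "M n * \<beta> powr (s - t) \<le> M n * (R powr (s - t)) ^ n" using M0 by simp
    then have "M n * \<beta> powr (s - t) < C" using n(1) by linarith
    then have "M n * \<beta> powr (s - t) * (3 * D) powr s < c * \<kappa> powr t"
      using D(1) by (simp add: C_def field_simps)
    also have "c * \<kappa> powr t \<le> M n * (x * (3 * D * \<beta>) powr s) * \<kappa> powr t"
      using cM by (intro mult_right_mono) (auto simp: x_def)
    also have "(3 * D * \<beta>) powr s = (3 * D) powr s * (\<beta> powr t * \<beta> powr (s - t))"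
      using D(1) \<beta> by (simp add: powr_mult powr_add[symmetric])
    \<comment> \<open>Written so that the common factor can be cancelled from both sides.\<close>
    finally have "1 * (M n * \<beta> powr (s - t) * (3 * D) powr s)
        < (x * (\<kappa> * \<beta>) powr t) * (M n * \<beta> powr (s - t) * (3 * D) powr s)"
      using \<kappa> \<beta> by (simp add: powr_mult mult_ac)
    moreover have "0 \<le> M n * \<beta> powr (s - t) * (3 * D) powr s" using M0 by simp
    ultimately have "1 < x * (\<kappa> * \<beta>) powr t" by (rule mult_right_less_imp_less)
    also have "\<dots> \<le> x * \<rho> powr t"
      using \<kappa>_le[OF i g] \<kappa> \<beta> t x by (intro mult_left_mono powr_mono2) (auto simp: \<rho>_def mult.commute)
    finally show ?thesis by (simp add: x_def)
  qed
  ultimately show thesis by (rule that)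
qed

end

section \<open>Passing from subsystems to the full dimension of \<open>K j\<close>\<close>

theorem theorem1p14:
  fixes q j :: nat
    and G :: "(nat, 'e) pre_digraph"
    and S :: "'e \<Rightarrow> 'a \<Rightarrow> 'a::euclidean_space"
    and r :: "'e \<Rightarrow> real"
    and T :: "'e \<Rightarrow> 'a \<Rightarrow> 'a"
    and v :: "'e \<Rightarrow> 'a"
    and K :: "nat \<Rightarrow> 'a set"
    and L :: "'a \<Rightarrow> 'b::euclidean_space"
  assumes "gd_ifs q G S r T v"
    and "strongly_connected G"
    and "is_attractor G S K"
    and "\<exists>i \<in> {1..q}. \<exists>x \<in> K i. \<exists>y \<in> K i. x \<noteq> y"
    and "j \<in> {1..q}"
    and "linear L"
    and "finite (transformation_group G T j)"
  shows "\<exists>\<delta>::real. \<delta> \<ge> 0 \<and>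
    (\<forall>\<epsilon>::real. \<epsilon> > 0 \<longrightarrow>
      ereal \<delta> + hausdorff_dim {y \<in> L ` K j. hausdorff_dim (L -` {y} \<inter> K j) \<ge> ereal (\<delta> - \<epsilon>)}
        \<ge> hausdorff_dim (K j))"
proof -
  interpret gd_ifs_attractor q G S r T v K
    using assms(1,3) by (simp add: gd_ifs_attractor_def gd_ifs_attractor_axioms_def)
  have j: "j \<in> verts G" using assms(5) verts_eq by simp
  define Y where "Y \<delta> = {y \<in> L ` K j. ereal \<delta> \<le> hausdorff_dim (L -` {y} \<inter> K j)}" for \<delta> :: real
  obtain b where b: "0 \<le> b" "hausdorff_measure b (K j) = 0" using ex_zero_hausdorff_measure[OF j] by blast
  have dim_nonneg: "0 \<le> hausdorff_dim (K j)" by (rule hausdorff_dim_nonneg[OF K_nonempty[OF j]])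
  obtain d where d: "hausdorff_dim (K j) = ereal d"
    using dim_nonneg hausdorff_dim_le[OF b] by (cases "hausdorff_dim (K j)") auto
  have d0: "0 \<le> d" using dim_nonneg d by simp
  have Y_mono: "Y \<delta> \<subseteq> Y \<delta>'" if "\<delta>' \<le> \<delta>" for \<delta> \<delta>'
    using that unfolding Y_def by (auto intro: order_trans[of "ereal \<delta>'" "ereal \<delta>"])
  \<comment> \<open>The bound \<open>\<delta> \<le> d\<close> keeps the exponents in a compact
    interval, from which a limit point is taken below.\<close>
  have approx: "\<exists>\<delta>. 0 \<le> \<delta> \<and> \<delta> \<le> d \<and> ereal (d - \<delta> - \<eta>) \<le> hausdorff_dim (Y \<delta>)" if \<eta>: "0 < \<eta>" for \<eta>
  \<comment> \<open>Dimension 0 leaves no room for an exponent t with \<open>0 \<le> t < d\<close>;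
    there \<open>\<delta> = 0\<close> works because every nonempty fibre has dimension at least
    0.\<close>
  proof (cases "d = 0")
    case True
    have "Y 0 \<noteq> {}"
    proof -
      obtain x where x: "x \<in> K j" using K_nonempty[OF j] by blast
      then have "0 \<le> hausdorff_dim (L -` {L x} \<inter> K j)" by (intro hausdorff_dim_nonneg) auto
      then have "L x \<in> Y 0" using x by (simp add: Y_def zero_ereal_def[symmetric])
      then show ?thesis by blast
    qed
    then have "0 \<le> hausdorff_dim (Y 0)" by (rule hausdorff_dim_nonneg)
    moreover have "ereal (d - 0 - \<eta>) \<le> 0" using True \<eta> by simp
    ultimately have "ereal (d - 0 - \<eta>) \<le> hausdorff_dim (Y 0)" by (rule order_trans[rotated])
    then show ?thesis using d0 by (intro exI[of _ 0]) simp
  next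
    case False
    \<comment> \<open>One third of \<open>\<eta>\<close> is spent on t and two thirds on the loss in
      \<open>dimension_conservation\<close>.\<close>
    define t where "t = max 0 (d - \<eta> / 3)"
    have t: "0 \<le> t" "ereal t < hausdorff_dim (K j)" "d - \<eta> / 3 \<le> t"
      using False d0 \<eta> by (auto simp: t_def d)
    obtain \<rho> N w where sub: "homogeneous_ifs \<rho> N w (K j) L" "1 \<le> real N * \<rho> powr t"
      using homogeneous_subsystem[OF assms(2) j assms(7,6) t(1,2)] by blast
    have "0 < \<eta> / 3" using \<eta> by simp
    then obtain \<delta> where \<delta>: "0 \<le> \<delta>" "Y \<delta> \<noteq> {}" "ereal (t - \<delta> - 2 * (\<eta> / 3)) \<le> hausdorff_dim (Y \<delta>)"
      unfolding Y_def by (rule homogeneous_ifs.dimension_conservation[OF sub]) blast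
    \<comment> \<open>A nonempty \<open>Y \<delta>\<close> has a fibre of dimension at least
      \<open>\<delta>\<close> inside \<open>K j\<close>, which forces
      \<open>\<delta> \<le> d\<close>.\<close>
    obtain y where "y \<in> Y \<delta>" using \<delta>(2) by blast
    then have "ereal \<delta> \<le> hausdorff_dim (L -` {y} \<inter> K j)" by (simp add: Y_def)
    also have "\<dots> \<le> hausdorff_dim (K j)" by (rule hausdorff_dim_mono) blast
    finally have "\<delta> \<le> d" by (simp add: d)
    moreover have "ereal (d - \<delta> - \<eta>) \<le> hausdorff_dim (Y \<delta>)"
      using t(3) by (intro order_trans[OF _ \<delta>(3)]) simp
    ultimately show ?thesis using \<delta>(1) by blast
  qed
  have "\<forall>n. \<exists>\<delta>. 0 \<le> \<delta> \<and> \<delta> \<le> d \<and> ereal (d - \<delta> - 1 / real (Suc n)) \<le> hausdorff_dim (Y \<delta>)"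
    using approx by simp
  then have "\<exists>\<delta>. \<forall>n. 0 \<le> \<delta> n \<and> \<delta> n \<le> d \<and> ereal (d - \<delta> n - 1 / real (Suc n)) \<le> hausdorff_dim (Y (\<delta> n))"
    by (rule choice)
  then obtain \<delta>s where \<delta>s: "\<And>n. \<delta>s n \<in> {0..d}"
    "\<And>n. ereal (d - \<delta>s n - 1 / real (Suc n)) \<le> hausdorff_dim (Y (\<delta>s n))" by auto
  obtain \<delta> \<phi> where \<delta>: "\<delta> \<in> {0..d}" "strict_mono \<phi>" "(\<delta>s \<circ> \<phi>) \<longlonglongrightarrow> \<delta>"
    using compact_Icc[of 0 d] \<delta>s(1) unfolding compact_def by blast
  \<comment> \<open>The exponents may approach \<open>\<delta>\<close> from below, so
    \<open>Y \<delta>\<close> need not contain the sets \<open>Y (\<delta>s (\<phi> n))\<close>;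
    lowering the threshold by \<open>\<epsilon>\<close> makes it contain all but finitely many of
    them.\<close>
  have "hausdorff_dim (K j) \<le> ereal \<delta> + hausdorff_dim (Y (\<delta> - \<epsilon>))" if \<epsilon>: "0 < \<epsilon>" for \<epsilon>
  proof -
    have lim: "(\<lambda>n. ereal (d - \<delta>s (\<phi> n) - 1 / real (Suc (\<phi> n)))) \<longlonglongrightarrow> ereal (d - \<delta> - 0)"
      using \<delta>(3) filterlim_compose[OF LIMSEQ_inverse_real_of_nat filterlim_subseq[OF \<delta>(2)]]
      by (intro tendsto_ereal tendsto_intros) (simp_all add: o_def inverse_eq_divide)
    have "\<forall>\<^sub>F n in sequentially. \<delta> - \<epsilon> < (\<delta>s \<circ> \<phi>) n"
      using \<epsilon> by (intro order_tendstoD(1)[OF \<delta>(3)]) simp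
    then have "\<forall>\<^sub>F n in sequentially. ereal (d - \<delta>s (\<phi> n) - 1 / real (Suc (\<phi> n))) \<le> hausdorff_dim (Y (\<delta> - \<epsilon>))"
    proof eventually_elim
      case (elim n)
      then have "hausdorff_dim (Y (\<delta>s (\<phi> n))) \<le> hausdorff_dim (Y (\<delta> - \<epsilon>))"
        by (intro hausdorff_dim_mono Y_mono) simp
      then show ?case using \<delta>s(2)[of "\<phi> n"] by (rule order_trans[rotated])
    qed
    then have "ereal (d - \<delta> - 0) \<le> hausdorff_dim (Y (\<delta> - \<epsilon>))"
      by (intro tendsto_upperbound[OF lim]) auto
    then have "ereal \<delta> + ereal (d - \<delta> - 0) \<le> ereal \<delta> + hausdorff_dim (Y (\<delta> - \<epsilon>))"
      by (rule add_left_mono)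
    then show ?thesis by (simp add: d)
  qed
  then show ?thesis using \<delta>(1) unfolding Y_def by (intro exI[of _ \<delta>]) auto
qed

end
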